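(* Let $X$ be an infinite compact simple space (with top point $\hat x$) that is cleavable over an infinite ordinal $Y$. If $X$ hereditarily has a spine, then $X$ is homeomorphic to an ordinal.
   Context: A space $X$ is cleavable over $Y$ if for every $A\subseteq X$ there is a continuous $f:X\to Y$ with $f(A)\cap f(X\setminus A)=\emptyset$ ($f$ cleaves along $A$). Ordinals carry the order topology. Derived sets: $X^0=X$, $X^{\alpha+1}=(X^\alpha)'$, $X^\lambda=\bigcap_{\alpha<\lambda}X^\alpha$ for limit $\lambda$; for compact scattered $X$, $\mathrm{CB}(X)=\beta+1$ is a successor and $X^\beta$ is finite, and $X$ is simple with $\hat x$ if $X^\beta=\{\hat x\}$. Let $X$ be infinite, compact, simple with $\hat x$, and cleavable over the infinite ordinal $Y$. A spine of $X$ is a pair $(S,k)$ with $S\subseteq X\setminus\{\hat x\}$ and $k:X\to Y$ continuous such that (1) $k(S)\cap k(X\setminus S)=\emptyset$, (2) $k|_S$ is an embedding into $Y$, (3) $k(S)$ is a closed unbounded subset of the ordinal $k(\hat x)$. $X$ hereditarily has a spine if every closed, infinite, simple subset $A\subseteq X$ (with its own top point, and regarded as cleavable over $Y$) has a spine. *)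

theory Defs
  imports "HOL-Analysis.Analysis"
begin

definition order_topology_rel :: "'a rel \<Rightarrow> 'a topology" where
  "order_topology_rel r = topology_generated_by
     (insert (Field r) ({underS r a | a. a \<in> Field r} \<union> {aboveS r a | a. a \<in> Field r}))"

text \<open>The Cantor-Bendixson derived sets X^alpha of X: the least family containing the
  whole space, closed under taking derived sets, and closed under intersections of
  nonempty subfamilies (this yields exactly the transfinite sequence of derived sets).\<close>
inductive_set CB_levels :: "'a topology \<Rightarrow> 'a set set" for X :: "'a topology" where
  top: "topspace X \<in> CB_levels X"
| deriv: "A \<in> CB_levels X \<Longrightarrow> X derived_set_of A \<in> CB_levels X"
| inter: "(\<forall>A\<in>F. A \<in> CB_levels X) \<Longrightarrow> F \<noteq> {} \<Longrightarrow> \<Inter>F \<in> CB_levels X"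

text \<open>X is (scattered and) simple with top point xh: the last nonempty derived set is {xh}.\<close>
definition simple_space :: "'a topology \<Rightarrow> 'a \<Rightarrow> bool" where
  "simple_space X xh \<longleftrightarrow> {xh} \<in> CB_levels X \<and> X derived_set_of {xh} = {}"

definition cleaves_along :: "'a topology \<Rightarrow> ('a \<Rightarrow> 'b) \<Rightarrow> 'a set \<Rightarrow> bool" where
  "cleaves_along X f A \<longleftrightarrow> f ` A \<inter> f ` (topspace X - A) = {}"

definition cleavable_over :: "'a topology \<Rightarrow> 'b topology \<Rightarrow> bool" where
  "cleavable_over X Y \<longleftrightarrow>
     (\<forall>A. A \<subseteq> topspace X \<longrightarrow> (\<exists>f. continuous_map X Y f \<and> cleaves_along X f A))"

text \<open>(S,k) is a spine of the simple space X with top point xh, w.r.t. the ordinal Y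
  given by the well-order r (with its order topology). The ordinal k(xh) is the
  initial segment underS r (k xh), carrying the subspace (= order) topology.\<close>
definition is_spine :: "'a topology \<Rightarrow> 'a \<Rightarrow> 'b rel \<Rightarrow> 'a set \<Rightarrow> ('a \<Rightarrow> 'b) \<Rightarrow> bool" where
  "is_spine X xh r S k \<longleftrightarrow>
     S \<subseteq> topspace X - {xh} \<and>
     continuous_map X (order_topology_rel r) k \<and>
     cleaves_along X k S \<and>
     embedding_map (subtopology X S) (order_topology_rel r) k \<and>
     k ` S \<subseteq> underS r (k xh) \<and>
     closedin (subtopology (order_topology_rel r) (underS r (k xh))) (k ` S) \<and>
     (\<forall>y\<in>underS r (k xh). \<exists>z\<in>k ` S. (y, z) \<in> r)"

definition hereditarily_has_spine :: "'a topology \<Rightarrow> 'b rel \<Rightarrow> bool" where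
  "hereditarily_has_spine X r \<longleftrightarrow>
     (\<forall>A a. closedin X A \<and> infinite A \<and> simple_space (subtopology X A) a \<longrightarrow>
        (\<exists>S k. is_spine (subtopology X A) a r S k))"

end

theory Submission
  imports Defs
begin

text \<open>
  It suffices to find, near every point, a clopen neighbourhood with a well-order whose rays are
  open. By scatteredness it is enough to treat a point \<open>xh\<close> all of whose companions have such
  neighbourhoods. Cleaving along \<open>{xh}\<close> gives a continuous map \<open>g\<close> into some \<open>\<alpha> + 1\<close> that takes the value \<open>\<alpha>\<close>
  only at \<open>xh\<close>; for the least possible \<open>\<alpha>\<close> this ordinal is regular. If \<open>\<alpha> = \<omega>\<close>, all other fibres of \<open>g\<close> are
  clopen and their well-orders can be concatenated. If \<open>\<alpha>\<close> is uncountable, it splits into two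
  stationary sets. Cleaving along suitable selections from the fibres over either part shows that
  over a club every fibre of \<open>g\<close> is clopen up to a single point. Cutting \<open>X\<close> along this club yields a
  continuous map to an ordinal all of whose fibres are singletons or clopen sets missing \<open>xh\<close>, and
  the lexicographic order does the rest.
\<close>

section \<open>Spaces with a compatible well-order\<close>

text \<open>The order topology is only required to be coarser than the given one. On a compact space the two
  then agree, and this formulation passes to subspaces without further ado.\<close>
definition wo_rays :: "'a topology \<Rightarrow> 'a rel \<Rightarrow> bool" where
  "wo_rays X s \<longleftrightarrow> Well_order s \<and> Field s = topspace X \<and>
     (\<forall>a\<in>topspace X. openin X (underS s a) \<and> openin X (aboveS s a))"

definition wo_space :: "'a topology \<Rightarrow> bool" where
  "wo_space X \<longleftrightarrow> (\<exists>s. wo_rays X s)"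

text \<open>Continuity into the order topology of \<open>'c\<close>, tested on open rays only, so
  that no topology has to be put on the type.\<close>

definition ray_continuous :: "'a topology \<Rightarrow> ('a \<Rightarrow> 'c::wellorder) \<Rightarrow> bool" where
  "ray_continuous X f \<longleftrightarrow>
     (\<forall>c. openin X {x \<in> topspace X. f x < c} \<and> openin X {x \<in> topspace X. c < f x})"

lemma Restr_rays:
  "underS (Restr s A) a = (if a \<in> A then underS s a \<inter> A else {})"
  "aboveS (Restr s A) a = (if a \<in> A then aboveS s a \<inter> A else {})"
  by (auto simp: underS_def aboveS_def)

lemma wo_space_subtopology:
  assumes "wo_space X"
  shows "wo_space (subtopology X A)"
proof -
  obtain s where s: "Well_order s" "Field s = topspace X"
      "\<forall>a\<in>topspace X. openin X (underS s a) \<and> openin X (aboveS s a)"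
    using assms by (auto simp: wo_space_def wo_rays_def)
  have "Refl s"
    using s(1) by (simp add: order_on_defs)
  then have "Field (Restr s A) = topspace (subtopology X A)"
    using s(2) by (simp add: Refl_Field_Restr)
  moreover have "openin (subtopology X A) (underS (Restr s A) a)"
      "openin (subtopology X A) (aboveS (Restr s A) a)"
    if "a \<in> topspace (subtopology X A)" for a
    using that s(3) by (auto simp: Restr_rays openin_subtopology)
  ultimately show ?thesis
    using Well_order_Restr[OF s(1), of A] unfolding wo_space_def wo_rays_def by blast
qed

section \<open>Preimages of rays and fibres\<close>

lemma ray_continuous_subtopology:
  assumes "ray_continuous X f"
  shows "ray_continuous (subtopology X A) f"
proof -
  have "{x \<in> topspace (subtopology X A). f x < c} = {x \<in> topspace X. f x < c} \<inter> A"
       "{x \<in> topspace (subtopology X A). c < f x} = {x \<in> topspace X. c < f x} \<inter> A" for c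
    by auto
  then show ?thesis
    using assms by (auto simp: ray_continuous_def openin_subtopology)
qed

lemma ray_continuous_closedin:
  assumes "ray_continuous X f"
  shows "closedin X {x \<in> topspace X. f x \<le> c}" "closedin X {x \<in> topspace X. c \<le> f x}"
proof -
  have "topspace X - {x \<in> topspace X. f x \<le> c} = {x \<in> topspace X. c < f x}"
       "topspace X - {x \<in> topspace X. c \<le> f x} = {x \<in> topspace X. f x < c}"
    by auto
  then show "closedin X {x \<in> topspace X. f x \<le> c}" "closedin X {x \<in> topspace X. c \<le> f x}"
    using assms by (auto simp: ray_continuous_def closedin_def)
qed

text \<open>Unless \<open>c\<close> is greatest it has a successor, the least \<open>d\<close> above
  \<open>c\<close>, and the closed initial segment at \<open>c\<close> is the open one at
  \<open>d\<close>.\<close>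

lemma ray_continuous_openin_le:
  assumes "ray_continuous X f"
  shows "openin X {x \<in> topspace X. f x \<le> c}"
proof (cases "\<exists>d. c < d")
  case True
  have "x \<le> c \<longleftrightarrow> x < (LEAST d. c < d)" for x
    using True by (metis LeastI linorder_not_le not_less_Least order_le_less_trans)
  then show ?thesis
    using assms by (simp add: ray_continuous_def)
next
  case False
  then have "{x \<in> topspace X. f x \<le> c} = topspace X"
    by (auto simp: not_less)
  then show ?thesis
    by simp
qed

lemma ray_continuous_fibre_closedin:
  assumes "ray_continuous X f"
  shows "closedin X {x \<in> topspace X. f x = c}"
proof -
  have "{x \<in> topspace X. f x = c} = {x \<in> topspace X. f x \<le> c} \<inter> {x \<in> topspace X. c \<le> f x}"
    by auto
  then show ?thesis
    by (simp only: closedin_Int ray_continuous_closedin[OF assms])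
qed

text \<open>The witness is the lexicographic order: first by \<open>h\<close>, then inside the fibres of \<open>h\<close>.\<close>
lemma wo_space_fibrewise:
  fixes h :: "'a \<Rightarrow> 'c::wellorder"
  assumes h: "ray_continuous X h"
    and fibre: "\<And>c. (\<exists>p. {x \<in> topspace X. h x = c} \<subseteq> {p}) \<or>
      openin X {x \<in> topspace X. h x = c} \<and> wo_space (subtopology X {x \<in> topspace X. h x = c})"
  shows "wo_space X"
proof -
  define H where "H c = {x \<in> topspace X. h x = c}" for c
  have "\<exists>s. Well_order s \<and> Field s = H c \<and>
      (\<forall>a\<in>H c. openin X (underS s a) \<and> openin X (aboveS s a))" for c
  proof (cases "\<exists>p. H c \<subseteq> {p}")
    case True
    then obtain p where "H c = {} \<or> H c = {p}"
      by blast
    then show ?thesis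
    proof
      assume "H c = {}"
      then show ?thesis
        by (intro exI[of _ "{}"]) (auto simp: order_on_defs refl_on_def trans_def antisym_def total_on_def)
    next
      \<comment> \<open>A one-point fibre need not be open: both rays of its order are
        empty.\<close>
      assume "H c = {p}"
      then show ?thesis
        by (intro exI[of _ "{(p,p)}"])
           (auto simp: order_on_defs refl_on_def trans_def antisym_def total_on_def Field_def
             underS_def aboveS_def)
    qed
  next
    case False
    then have o: "openin X (H c)" and "wo_space (subtopology X (H c))"
      using fibre[of c] by (auto simp: H_def)
    then obtain s where s: "wo_rays (subtopology X (H c)) s"
      by (auto simp: wo_space_def)
    have "topspace (subtopology X (H c)) = H c"
      by (auto simp: H_def)
    then show ?thesis
      using s o by (intro exI[of _ s]) (auto simp: wo_rays_def openin_open_subtopology)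
  qed
  then obtain S where S: "\<And>c. Well_order (S c)" "\<And>c. Field (S c) = H c"
    and under: "\<And>a c. a \<in> H c \<Longrightarrow> openin X (underS (S c) a)"
    and above: "\<And>a c. a \<in> H c \<Longrightarrow> openin X (aboveS (S c) a)"
    by metis
  have SH: "a \<in> H c" "b \<in> H c" if "(a, b) \<in> S c" for a b c
    using that S(2)[of c] by (auto simp: Field_def)
  define s where "s = {(a, b). a \<in> topspace X \<and> b \<in> topspace X \<and>
      (h a < h b \<or> h a = h b \<and> (a, b) \<in> S (h a))}"
  have refl_S: "(a, a) \<in> S (h a)" if "a \<in> topspace X" for a
    using S[of "h a"] that by (auto simp: order_on_defs refl_on_def H_def)
  have Field_s: "Field s = topspace X"
    using refl_S by (auto simp: s_def Field_def)
  have trans_S: "trans (S c)" and antisym_S: "antisym (S c)" and wf_S: "wf (S c - Id)" for c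
    using S(1)[of c] by (auto simp: order_on_defs)
  have total_S: "(a, b) \<in> S (h a) \<or> (b, a) \<in> S (h a)"
    if "a \<in> topspace X" "b \<in> topspace X" "h a = h b" "a \<noteq> b" for a b
    using S(1)[of "h a"] S(2)[of "h a"] that by (auto simp: order_on_defs total_on_def H_def)
  \<comment> \<open>The strict fibre orders live on disjoint sets, so their union \<open>R\<close>
    is well-founded and an ordinary lexicographic product suffices.\<close>
  have "wf (s - Id)"
  proof (rule wf_subset)
    define R where "R = (\<Union>c. S c - Id)"
    have "wf R"
      unfolding R_def
    proof (rule wf_UN)
      fix i j :: 'c
      assume "S i - Id \<noteq> S j - Id"
      then have "i \<noteq> j" by auto
      then show "Domain (S i - Id) \<inter> Range (S j - Id) = {}"
        using SH by (fastforce simp: H_def)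
    qed (simp add: wf_S)
    then show "wf (inv_image ({(x, y). x < y} <*lex*> R) (\<lambda>a. (h a, a)))"
      by (intro wf_inv_image wf_lex_prod) (simp_all add: wf)
    show "s - Id \<subseteq> inv_image ({(x, y). x < y} <*lex*> R) (\<lambda>a. (h a, a))"
      by (auto simp: s_def R_def)
  qed
  moreover have "Refl s"
    using Field_s refl_S by (auto simp: refl_on_def s_def)
  moreover have "trans s"
  proof (rule transI)
    fix a b c assume "(a, b) \<in> s" "(b, c) \<in> s"
    then show "(a, c) \<in> s"
      using trans_S[of "h a"] by (auto simp: s_def dest: transD)
  qed
  moreover have "antisym s"
    using antisym_S by (auto simp: s_def antisym_def)
  moreover have "total_on (Field s) s"
    unfolding Field_s total_on_def
  proof (intro ballI impI)
    fix a b assume ab: "a \<in> topspace X" "b \<in> topspace X" "a \<noteq> b"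
    consider "h a < h b" | "h b < h a" | "h a = h b"
      by fastforce
    then show "(a, b) \<in> s \<or> (b, a) \<in> s"
      by cases (use ab total_S[of a b] in \<open>simp_all add: s_def\<close>)
  qed
  moreover have "s \<subseteq> Field s \<times> Field s"
    by (auto intro: FieldI1 FieldI2)
  ultimately have "Well_order s"
    unfolding order_on_defs by simp
  moreover have "openin X (underS s a)" "openin X (aboveS s a)" if a: "a \<in> topspace X" for a
  proof -
    have aH: "a \<in> H (h a)"
      using a by (simp add: H_def)
    have S1: "x \<in> topspace X \<and> h x = h a" if "(x, a) \<in> S (h a) \<or> (a, x) \<in> S (h a)" for x
      using that SH[of x a "h a"] SH[of a x "h a"] by (auto simp: H_def)
    have "x \<in> underS s a \<longleftrightarrow> x \<in> topspace X \<and> h x < h a \<or> x \<in> underS (S (h a)) a" for x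
      unfolding s_def underS_def mem_Collect_eq prod.case using S1[of x] a
      by (metis order_less_irrefl)
    then have "underS s a = {x \<in> topspace X. h x < h a} \<union> underS (S (h a)) a"
      by blast
    then show "openin X (underS s a)"
      using h under[OF aH] by (auto simp: ray_continuous_def)
    have "x \<in> aboveS s a \<longleftrightarrow> x \<in> topspace X \<and> h a < h x \<or> x \<in> aboveS (S (h a)) a" for x
      unfolding s_def aboveS_def mem_Collect_eq prod.case using S1[of x] a
      by (metis order_less_irrefl)
    then have "aboveS s a = {x \<in> topspace X. h a < h x} \<union> aboveS (S (h a)) a"
      by blast
    then show "openin X (aboveS s a)"
      using h above[OF aH] by (auto simp: ray_continuous_def)
  qed
  ultimately show ?thesis
    using Field_s unfolding wo_space_def wo_rays_def by blast
qed

section \<open>Gluing along clopen sets\<close>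

lemma wo_space_subsingleton:
  assumes "topspace X \<subseteq> {p}"
  shows "wo_space X"
proof (rule wo_space_fibrewise[where h = "\<lambda>_. 0::nat"])
  have "openin X {x \<in> topspace X. P}" for P
    by (cases P) simp_all
  then show "ray_continuous X (\<lambda>_. 0::nat)"
    by (simp add: ray_continuous_def)
qed (use assms in auto)

lemma wo_space_clopen_split:
  assumes A: "openin X A" "closedin X A"
    and "wo_space (subtopology X A)" "wo_space (subtopology X (topspace X - A))"
  shows "wo_space X"
proof (rule wo_space_fibrewise[where h = "\<lambda>x. if x \<in> A then 0 else 1::nat"])
  let ?h = "\<lambda>x. if x \<in> A then 0 else 1::nat"
  have *: "openin X {x \<in> topspace X. P (?h x)}" for P
  proof -
    have "openin X ((if P 0 then A else {}) \<union> (if P 1 then topspace X - A else {}))"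
      using A by auto
    also have "(if P 0 then A else {}) \<union> (if P 1 then topspace X - A else {})
        = {x \<in> topspace X. P (?h x)}"
      using openin_subset[OF A(1)] by auto
    finally show ?thesis .
  qed
  show "ray_continuous X ?h"
    unfolding ray_continuous_def by (intro allI conjI *)
  fix c :: nat
  define Z where "Z = {x \<in> topspace X. ?h x = c}"
  have "Z = A" if "c = 0"
    using openin_subset[OF A(1)] that by (auto simp: Z_def)
  moreover have "Z = topspace X - A" if "c = 1"
    using that by (auto simp: Z_def)
  moreover have "Z = {}" if "c \<noteq> 0" "c \<noteq> 1"
    using that by (auto simp: Z_def)
  moreover have "openin X Z"
    unfolding Z_def by (rule *)
  ultimately have "(\<exists>p. Z \<subseteq> {p}) \<or> openin X Z \<and> wo_space (subtopology X Z)"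
    using assms(3,4) by blast
  then show "(\<exists>p. {x \<in> topspace X. ?h x = c} \<subseteq> {p}) \<or>
      openin X {x \<in> topspace X. ?h x = c} \<and> wo_space (subtopology X {x \<in> topspace X. ?h x = c})"
    unfolding Z_def .
qed

text \<open>Compactness leaves finitely many clopen pieces, which are joined one at a time.\<close>

lemma wo_space_locally:
  assumes "compact_space X"
    and loc: "\<And>x. x \<in> topspace X \<Longrightarrow>
      \<exists>C. x \<in> C \<and> openin X C \<and> closedin X C \<and> wo_space (subtopology X C)"
  shows "wo_space X"
proof -
  define \<C> where "\<C> = {C. openin X C \<and> closedin X C \<and> wo_space (subtopology X C)}"
  have "topspace X \<subseteq> \<Union>\<C>" "\<And>C. C \<in> \<C> \<Longrightarrow> openin X C"
    using loc by (auto simp: \<C>_def)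
  then obtain \<F> where \<F>: "finite \<F>" "\<F> \<subseteq> \<C>" "topspace X \<subseteq> \<Union>\<F>"
    using assms(1) unfolding compact_space_alt by meson
  have "\<Union>\<F> \<in> \<C>"
    using \<F>(1,2)
  proof (induction \<F>)
    case empty
    have "wo_space (subtopology X {})"
      by (rule wo_space_subsingleton) simp
    then show ?case
      by (simp add: \<C>_def)
  next
    case (insert A \<F>)
    then have A: "A \<in> \<C>" and B: "\<Union>\<F> \<in> \<C>"
      by auto
    let ?B = "\<Union>\<F>"
    let ?Y = "subtopology X (A \<union> ?B)"
    have sub: "A \<subseteq> topspace X"
      using A openin_subset by (auto simp: \<C>_def)
    have "openin ?Y A" "closedin ?Y A"
      using A by (auto simp: \<C>_def openin_subtopology closedin_subtopology)
    moreover have "wo_space (subtopology ?Y A)"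
      using A by (simp add: \<C>_def subtopology_subtopology Int_absorb1)
    \<comment> \<open>What lies outside \<open>A\<close> is a subspace of the union already treated,
      so overlaps do no harm.\<close>
    moreover have "wo_space (subtopology ?Y (topspace ?Y - A))"
    proof -
      have "subtopology ?Y (topspace ?Y - A) = subtopology (subtopology X ?B) (- A)"
        using openin_subset[of X ?B] B
        by (simp add: subtopology_subtopology \<C>_def) (rule arg_cong[where f = "subtopology X"], auto)
      then show ?thesis
        using B by (auto simp: \<C>_def intro: wo_space_subtopology)
    qed
    ultimately have "wo_space ?Y"
      by (rule wo_space_clopen_split)
    then show ?case
      using A B by (auto simp: \<C>_def)
  qed
  moreover have "\<Union>\<F> = topspace X"
    using \<F>(3) calculation openin_subset[of X "\<Union>\<F>"] by (auto simp: \<C>_def)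
  ultimately show ?thesis
    by (simp add: \<C>_def)
qed

section \<open>The order topology of a well-order\<close>

lemma openin_order_topology_rays:
  assumes "a \<in> Field s"
  shows "openin (order_topology_rel s) (underS s a)" "openin (order_topology_rel s) (aboveS s a)"
  using assms unfolding order_topology_rel_def
  by (auto intro!: topology_generated_by_Basis)

lemma topspace_order_topology_rel: "topspace (order_topology_rel s) = Field s"
proof -
  have "underS s a \<subseteq> Field s" "aboveS s a \<subseteq> Field s" for a
    by (auto simp: underS_def aboveS_def Field_def)
  then show ?thesis
    unfolding order_topology_rel_def topology_generated_by_topspace by auto
qed

text \<open>A point strictly between two others separates them by its two rays; if there is none,
  the ray below the larger and the ray above the smaller are disjoint.\<close>

lemma Hausdorff_order_topology_rel:
  assumes "Well_order s"
  shows "Hausdorff_space (order_topology_rel s)"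
proof -
  have s: "Refl s" "trans s" "antisym s" "total_on (Field s) s"
    using assms by (auto simp: order_on_defs)
  have *: "\<exists>U V. openin (order_topology_rel s) U \<and> openin (order_topology_rel s) V
      \<and> x \<in> U \<and> y \<in> V \<and> disjnt U V"
    if xy: "(x, y) \<in> s" "x \<noteq> y" for x y
  proof (cases "\<exists>z. (x, z) \<in> s \<and> (z, y) \<in> s \<and> z \<noteq> x \<and> z \<noteq> y")
    case True
    then obtain z where z: "(x, z) \<in> s" "(z, y) \<in> s" "z \<noteq> x" "z \<noteq> y"
      by blast
    have "z \<in> Field s"
      using z by (auto simp: Field_def)
    moreover have "disjnt (underS s z) (aboveS s z)"
      using s by (auto simp: disjnt_iff underS_def aboveS_def dest: antisymD)
    ultimately show ?thesis
      using z openin_order_topology_rays[of z s]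
      by (intro exI[of _ "underS s z"] exI[of _ "aboveS s z"]) (auto simp: underS_def aboveS_def)
  next
    case False
    have "x \<in> Field s" "y \<in> Field s"
      using xy by (auto simp: Field_def)
    moreover have "disjnt (underS s y) (aboveS s x)"
      using False by (auto simp: disjnt_iff underS_def aboveS_def)
    ultimately show ?thesis
      using xy openin_order_topology_rays
      by (intro exI[of _ "underS s y"] exI[of _ "aboveS s x"]) (auto simp: underS_def aboveS_def)
  qed
  show ?thesis
    unfolding Hausdorff_space_def topspace_order_topology_rel
  proof (intro allI impI)
    fix x y assume xy: "x \<in> Field s \<and> y \<in> Field s \<and> x \<noteq> y"
    then have "(x, y) \<in> s \<or> (y, x) \<in> s"
      using s(4) by (auto simp: total_on_def)
    then show "\<exists>U V. openin (order_topology_rel s) U \<and> openin (order_topology_rel s) V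
        \<and> x \<in> U \<and> y \<in> V \<and> disjnt U V"
    proof
      assume "(x, y) \<in> s"
      then show ?thesis using * xy by blast
    next
      assume "(y, x) \<in> s"
      then show ?thesis using *[of y x] xy by (metis disjnt_sym)
    qed
  qed
qed

text \<open>The identity is a continuous bijection from a compact space to a Hausdorff one.\<close>

lemma wo_rays_homeomorphic:
  assumes "compact_space X" "wo_rays X s"
  shows "X homeomorphic_space order_topology_rel s"
proof -
  have s: "Well_order s" "Field s = topspace X"
    using assms(2) by (auto simp: wo_rays_def)
  have "continuous_map X (order_topology_rel s) id"
    unfolding order_topology_rel_def
  proof (rule continuous_on_generated_topo)
    fix U assume "U \<in> insert (Field s) ({underS s a |a. a \<in> Field s} \<union> {aboveS s a |a. a \<in> Field s})"
    then have "openin X U"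
      using assms(2) by (auto simp: wo_rays_def)
    then show "openin X (id -` U \<inter> topspace X)"
      by (simp add: openin_subset Int_absorb2)
  next
    show "id ` topspace X \<subseteq> \<Union> (insert (Field s) ({underS s a |a. a \<in> Field s} \<union> {aboveS s a |a. a \<in> Field s}))"
      using s by auto
  qed
  then have "homeomorphic_map X (order_topology_rel s) id"
    using assms(1) Hausdorff_order_topology_rel[OF s(1)] s(2)
    by (intro continuous_imp_homeomorphic_map) (auto simp: topspace_order_topology_rel)
  then show ?thesis
    by (rule homeomorphic_map_imp_homeomorphic_space)
qed

section \<open>Stationary subsets of a regular limit ordinal\<close>

text \<open>Says that \<open>\<alpha>\<close> is, up to order type, an uncountable regular cardinal:
  \<open>bounded_initial\<close> is regularity, and \<open>bounded_seq\<close> excludes \<omega>,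
  which satisfies the other three conditions.\<close>

locale regular_limit =
  fixes \<alpha> :: "'c::wellorder"
  assumes nonempty: "\<exists>j. j < \<alpha>"
    and limit: "j < \<alpha> \<Longrightarrow> \<exists>k>j. k < \<alpha>"
    and bounded_initial: "j < \<alpha> \<Longrightarrow> (\<And>i. i < j \<Longrightarrow> F i < \<alpha>) \<Longrightarrow> \<exists>b<\<alpha>. \<forall>i<j. F i \<le> b"
    and bounded_seq: "(\<And>n::nat. G n < \<alpha>) \<Longrightarrow> \<exists>b<\<alpha>. \<forall>n. G n \<le> b"
begin

definition maps_below :: "('c \<Rightarrow> 'c) \<Rightarrow> bool" where
  "maps_below F \<longleftrightarrow> (\<forall>j<\<alpha>. F j < \<alpha>)"

definition closure_point :: "('c \<Rightarrow> 'c) \<Rightarrow> 'c \<Rightarrow> bool" where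
  "closure_point F i \<longleftrightarrow> (\<exists>j. j < i) \<and> (\<forall>j<i. F j < i)"

text \<open>The closure points of a function form a club, and every club contains such a set;
  so this is stationarity in the usual sense, without any mention of clubs.\<close>
definition stationary :: "'c set \<Rightarrow> bool" where
  "stationary W \<longleftrightarrow> (\<forall>F. maps_below F \<longrightarrow> (\<exists>i<\<alpha>. closure_point F i \<and> i \<in> W))"

lemma strict_bound_le:
  assumes "j < \<alpha>" "\<And>i. i \<le> j \<Longrightarrow> F i < \<alpha>"
  shows "\<exists>b<\<alpha>. \<forall>i\<le>j. F i < b"
proof -
  obtain k where k: "j < k" "k < \<alpha>"
    using limit assms(1) by blast
  \<comment> \<open>\<open>k\<close> may exceed the successor of \<open>j\<close>;
    \<open>min i j\<close> keeps the arguments where \<open>F\<close> is known to stay below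
    \<open>\<alpha>\<close>.\<close>
  obtain b where b: "b < \<alpha>" "\<And>i. i < k \<Longrightarrow> F (min i j) \<le> b"
    using bounded_initial[OF k(2), of "\<lambda>i. F (min i j)"] assms(2) by auto
  obtain c where "b < c" "c < \<alpha>"
    using limit b(1) by blast
  moreover have "F i < c" if "i \<le> j" for i
    using b(2)[of i] le_less_trans[OF that k(1)] that \<open>b < c\<close> by (simp add: min_absorb1)
  ultimately show ?thesis
    by blast
qed

lemma strict_bound_seq:
  assumes "\<And>n::nat. F n < \<alpha>"
  shows "\<exists>b<\<alpha>. \<forall>n. F n < b"
  using bounded_seq[OF assms] limit by (meson order_le_less_trans)

text \<open>Diagonal intersection of clubs: \<open>F m\<close> is chosen above all
  \<open>G \<xi> j\<close> with \<open>\<xi>\<close> and \<open>j\<close> at most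
  \<open>m\<close>.\<close>

lemma diagonal:
  assumes "\<And>\<xi>. \<xi> < \<alpha> \<Longrightarrow> maps_below (G \<xi>)"
  shows "\<exists>F. maps_below F \<and> (\<forall>i\<le>\<alpha>. closure_point F i \<longrightarrow> (\<forall>\<xi><i. closure_point (G \<xi>) i))"
proof -
  have "\<exists>b<\<alpha>. (\<forall>\<xi>\<le>m. \<forall>j\<le>m. G \<xi> j < b)" if m: "m < \<alpha>" for m
  proof -
    have "\<exists>b<\<alpha>. \<forall>j\<le>m. G \<xi> j < b" if "\<xi> \<le> m" for \<xi>
      by (rule strict_bound_le) (use assms that m in \<open>auto simp: maps_below_def\<close>)
    then obtain B where B: "\<And>\<xi>. \<xi> \<le> m \<Longrightarrow> B \<xi> < \<alpha>" "\<And>\<xi> j. \<xi> \<le> m \<Longrightarrow> j \<le> m \<Longrightarrow> G \<xi> j < B \<xi>"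
      by metis
    obtain c where c: "c < \<alpha>" "\<And>\<xi>. \<xi> \<le> m \<Longrightarrow> B \<xi> < c"
      using strict_bound_le[of m B] B(1) m by blast
    then show ?thesis
      using B(2) by (intro exI[of _ c]) (auto intro: less_trans)
  qed
  then obtain F where F: "\<And>m. m < \<alpha> \<Longrightarrow> F m < \<alpha>"
      "\<And>m \<xi> j. m < \<alpha> \<Longrightarrow> \<xi> \<le> m \<Longrightarrow> j \<le> m \<Longrightarrow> G \<xi> j < F m"
    by metis
  have "closure_point (G \<xi>) i" if i: "i \<le> \<alpha>" "closure_point F i" "\<xi> < i" for i \<xi>
    unfolding closure_point_def
  proof (intro conjI allI impI)
    show "\<exists>j. j < i"
      using i by blast
    fix j assume "j < i"
    then have m: "max \<xi> j < i"
      using i by simp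
    then have "G \<xi> j < F (max \<xi> j)"
      using F(2)[of "max \<xi> j" \<xi> j] less_le_trans[OF m i(1)] by simp
    also have "\<dots> < i"
      using i(2) m by (simp add: closure_point_def)
    finally show "G \<xi> j < i" .
  qed
  then show ?thesis
    using F(1) unfolding maps_below_def by blast
qed

lemma closure_point_max:
  assumes "closure_point (\<lambda>j. max (F j) (G j)) i"
  shows "closure_point F i" "closure_point G i"
  using assms by (auto simp: closure_point_def)

lemma maps_below_max: "maps_below F \<Longrightarrow> maps_below G \<Longrightarrow> maps_below (\<lambda>j. max (F j) (G j))"
  by (simp add: maps_below_def)

text \<open>A pointwise strict bound of all \<open>G n\<close> works; \<open>bounded_seq\<close>
  keeps it below \<open>\<alpha>\<close>.\<close>

lemma countable_intersection:
  assumes "\<And>n::nat. maps_below (G n)"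
  shows "\<exists>F. maps_below F \<and> (\<forall>i\<le>\<alpha>. closure_point F i \<longrightarrow> (\<forall>n. closure_point (G n) i))"
proof -
  have "\<exists>b<\<alpha>. \<forall>n. G n m < b" if "m < \<alpha>" for m
    by (rule strict_bound_seq) (use assms that in \<open>auto simp: maps_below_def\<close>)
  then obtain F where "\<And>m. m < \<alpha> \<Longrightarrow> F m < \<alpha>" "\<And>m n. m < \<alpha> \<Longrightarrow> G n m < F m"
    by metis
  then show ?thesis
    by (intro exI[of _ F]) (auto simp: maps_below_def closure_point_def, meson less_le_trans less_trans)
qed

text \<open>Makes \<open>i\<close> a limit of countable cofinality, with \<open>a\<close> as a
  ladder that may fail to increase.\<close>

definition cofinal_seq :: "(nat \<Rightarrow> 'c) \<Rightarrow> 'c \<Rightarrow> bool" where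
  "cofinal_seq a i \<longleftrightarrow> (\<forall>n. a n < i) \<and> (\<forall>j<i. \<exists>n. j < a n)"

text \<open>Iterate from \<open>b\<close> a function \<open>N\<close> that exceeds the identity and
  all earlier values of \<open>F\<close>; the supremum of the iterates is the required point, below
  \<open>\<alpha>\<close> by \<open>bounded_seq\<close>.\<close>

lemma closure_point_above:
  assumes F: "maps_below F" and b: "b < \<alpha>"
  shows "\<exists>i<\<alpha>. b < i \<and> closure_point F i \<and> (\<exists>a. cofinal_seq a i)"
proof -
  have "\<exists>c<\<alpha>. m < c \<and> (\<forall>j\<le>m. F j < c)" if m: "m < \<alpha>" for m
  proof -
    obtain d where "d < \<alpha>" "\<forall>j\<le>m. F j < d"
      using strict_bound_le[of m F] m F by (auto simp: maps_below_def)
    moreover obtain e where "m < e" "e < \<alpha>"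
      using limit m by blast
    ultimately show ?thesis
      by (intro exI[of _ "max d e"]) (auto simp: less_max_iff_disj)
  qed
  then obtain N where N: "\<And>m. m < \<alpha> \<Longrightarrow> N m < \<alpha>" "\<And>m. m < \<alpha> \<Longrightarrow> m < N m"
      "\<And>m j. m < \<alpha> \<Longrightarrow> j \<le> m \<Longrightarrow> F j < N m"
    by metis
  define a where "a n = (N ^^ n) b" for n
  have a: "a n < \<alpha>" for n
    by (induction n) (simp_all add: a_def b N(1))
  define i where "i = (LEAST i. \<forall>n. a n < i)"
  obtain u where u: "u < \<alpha>" "\<forall>n. a n < u"
    using strict_bound_seq a by blast
  have i: "a n < i" for n
    unfolding i_def by (rule LeastI2[of _ u]) (use u in auto)
  have "i < \<alpha>"
    unfolding i_def using Least_le[of "\<lambda>i. \<forall>n. a n < i" u] u by simp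
  have cof: "\<exists>n. j < a n" if "j < i" for j
  proof -
    have "\<exists>n. j \<le> a n"
      using not_less_Least[of j "\<lambda>i. \<forall>n. a n < i"] that by (auto simp: i_def not_less)
    then obtain n where "j \<le> a n"
      by blast
    also have "\<dots> < a (Suc n)"
      using N(2)[OF a] by (simp add: a_def)
    finally show ?thesis
      by blast
  qed
  have "F j < i" if j: "j < i" for j
  proof -
    obtain n where "j < a n"
      using cof j by blast
    then have "F j < a (Suc n)"
      using N(3)[OF a] by (simp add: a_def)
    then show ?thesis
      using i less_trans by blast
  qed
  moreover have "b < i"
    using i[of 0] by (simp add: a_def)
  ultimately have "b < i \<and> closure_point F i \<and> cofinal_seq a i"
    using i cof by (auto simp: closure_point_def cofinal_seq_def)
  then show ?thesis
    using \<open>i < \<alpha>\<close> by blast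
qed

text \<open>Otherwise stationarity would be decided by an ultrafilter closed under diagonal and countable
  intersections. Applied to the entries of a ladder system on the points of countable cofinality,
  it would bound all the ladders of a large set of points by one and the same ordinal.\<close>
lemma stationary_split: "\<exists>W. stationary W \<and> stationary (- W)"
proof (rule ccontr)
  assume "\<not> ?thesis"
  \<comment> \<open>The ultrafilter: each \<open>W\<close> contains all or none of the closure
    points of a suitable function.\<close>
  then have decide: "\<exists>F. maps_below F \<and>
      ((\<forall>i<\<alpha>. closure_point F i \<longrightarrow> i \<in> W) \<or> (\<forall>i<\<alpha>. closure_point F i \<longrightarrow> i \<notin> W))" for W
    unfolding stationary_def Compl_iff by metis
  define a where "a i = (SOME a. cofinal_seq a i)" for i
  have a: "cofinal_seq (a i) i" if "\<exists>a. cofinal_seq a i" for i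
    unfolding a_def using that by (rule someI_ex)
  \<comment> \<open>On a club one \<open>\<xi>\<close> bounds all the \<open>n\<close>-th ladder
    entries. Otherwise \<open>decide\<close> gives the opposite for each \<open>\<xi>\<close>, and a
    diagonal intersection yields \<open>\<xi> < a i n\<close> for all \<open>\<xi> < i\<close>,
    which fails for \<open>\<xi> = a i n\<close>.\<close>
  have "\<exists>\<xi> F. \<xi> < \<alpha> \<and> maps_below F \<and>
      (\<forall>i<\<alpha>. closure_point F i \<longrightarrow> (\<exists>a. cofinal_seq a i) \<longrightarrow> a i n \<le> \<xi>)" for n
  proof (rule ccontr)
    assume no: "\<not> ?thesis"
    have "\<exists>F. maps_below F \<and>
        (\<forall>i<\<alpha>. closure_point F i \<longrightarrow> (\<exists>a. cofinal_seq a i) \<and> \<xi> < a i n)" if "\<xi> < \<alpha>" for \<xi>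
      using decide[of "{i. (\<exists>a. cofinal_seq a i) \<longrightarrow> a i n \<le> \<xi>}"] no that
      unfolding mem_Collect_eq not_imp not_le by blast
    then obtain G where G: "\<And>\<xi>. \<xi> < \<alpha> \<Longrightarrow> maps_below (G \<xi>)"
        "\<And>\<xi> i. \<xi> < \<alpha> \<Longrightarrow> i < \<alpha> \<Longrightarrow> closure_point (G \<xi>) i \<Longrightarrow> \<xi> < a i n"
      by metis
    obtain F where F: "maps_below F" "\<forall>i\<le>\<alpha>. closure_point F i \<longrightarrow> (\<forall>\<xi><i. closure_point (G \<xi>) i)"
      using diagonal[of G] G(1) by blast
    obtain j where "j < \<alpha>"
      using nonempty by blast
    then obtain i where i: "i < \<alpha>" "closure_point F i" "\<exists>a. cofinal_seq a i"
      using closure_point_above[OF F(1)] by blast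
    have lt: "a i n < i"
      using a[OF i(3)] by (simp add: cofinal_seq_def)
    then have "closure_point (G (a i n)) i"
      using F(2) i by simp
    then show False
      using G(2)[of "a i n" i] lt i(1) by (meson less_irrefl less_trans)
  qed
  then obtain \<xi> G where \<xi>: "\<And>n. \<xi> n < \<alpha>" and G: "\<And>n. maps_below (G n)"
    and le: "\<And>n i. i < \<alpha> \<Longrightarrow> closure_point (G n) i \<Longrightarrow> \<exists>a. cofinal_seq a i \<Longrightarrow> a i n \<le> \<xi> n"
    by metis
  \<comment> \<open>Intersecting over \<open>n\<close> puts whole ladders below one
    \<open>b\<close>, although \<open>i\<close> can be taken above \<open>b\<close>.\<close>
  obtain F where F: "maps_below F" "\<forall>i\<le>\<alpha>. closure_point F i \<longrightarrow> (\<forall>n. closure_point (G n) i)"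
    using countable_intersection[of G] G by blast
  obtain b where b: "b < \<alpha>" "\<And>n. \<xi> n < b"
    using strict_bound_seq[of \<xi>] \<xi> by blast
  obtain i where i: "i < \<alpha>" "b < i" "closure_point F i" "\<exists>a. cofinal_seq a i"
    using closure_point_above[OF F(1) b(1)] by blast
  have "a i n \<le> \<xi> n" for n
    using F(2) i le by simp
  moreover obtain n where "b < a i n"
    using a[OF i(4)] i(2) by (auto simp: cofinal_seq_def)
  ultimately show False
    using b(2) by (meson less_asym less_le_trans)
qed

end

section \<open>Fibres over a club\<close>

text \<open>If \<open>K\<close> missed the fibre over \<open>i\<close>, the open sets where
  \<open>g\<close> is at most some \<open>j < i\<close> would cover the part of \<open>K\<close> up
  to \<open>i\<close>; a finite subcover bounds \<open>g\<close> there by some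
  \<open>m < i\<close>.\<close>

lemma fibre_limit:
  assumes "compact_space X" and g: "ray_continuous X g" and K: "closedin X K"
    and i: "\<exists>j. j < i" and acc: "\<And>j. j < i \<Longrightarrow> \<exists>x\<in>K. j < g x \<and> g x \<le> i"
  shows "\<exists>x\<in>K. g x = i"
proof (rule ccontr)
  assume no: "\<not> ?thesis"
  define K' where "K' = K \<inter> {x \<in> topspace X. g x \<le> i}"
  have "closedin X K'"
    unfolding K'_def using K ray_continuous_closedin(1)[OF g] by (rule closedin_Int)
  then have cK: "compactin X K'"
    by (rule closedin_compact_space[OF assms(1)])
  have "K' \<subseteq> \<Union> ((\<lambda>j. {x \<in> topspace X. g x \<le> j}) ` {..<i})"
    using no by (force simp: K'_def less_le)
  moreover have "openin X U" if "U \<in> (\<lambda>j. {x \<in> topspace X. g x \<le> j}) ` {..<i}" for U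
    using that ray_continuous_openin_le[OF g] by auto
  ultimately obtain \<F> where \<F>: "finite \<F>" "\<F> \<subseteq> (\<lambda>j. {x \<in> topspace X. g x \<le> j}) ` {..<i}" "K' \<subseteq> \<Union>\<F>"
    using cK[unfolded compactin_def, THEN conjunct2, rule_format,
        of "(\<lambda>j. {x \<in> topspace X. g x \<le> j}) ` {..<i}"] by blast
  obtain J where "J \<subseteq> {..<i}" "finite J" "\<F> = (\<lambda>j. {x \<in> topspace X. g x \<le> j}) ` J"
    using finite_subset_image[OF \<F>(1,2)] by blast
  then have J: "finite J" "J \<subseteq> {..<i}" "K' \<subseteq> \<Union> ((\<lambda>j. {x \<in> topspace X. g x \<le> j}) ` J)"
    using \<F>(3) by simp_all
  obtain j0 where "j0 < i"
    using i by blast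
  \<comment> \<open>\<open>j0\<close> keeps the maximum defined when the subcover is empty.\<close>
  define m where "m = Max (insert j0 J)"
  have m: "m < i" "\<And>j. j \<in> J \<Longrightarrow> j \<le> m"
    using J(1,2) \<open>j0 < i\<close> by (auto simp: m_def)
  obtain x where x: "x \<in> K" "m < g x" "g x \<le> i"
    using acc[OF m(1)] by blast
  then have "x \<in> K'"
    using closedin_subset[OF K] by (auto simp: K'_def)
  then obtain j where "j \<in> J" "g x \<le> j"
    using J(3) by blast
  then show False
    using m(2) x(2) by (meson le_less_trans less_le_trans less_irrefl)
qed

text \<open>Failure would give, by \<open>fibre_limit\<close> for the complement of
  \<open>V\<close>, a point outside \<open>V\<close> over \<open>g p\<close>, where only
  \<open>p\<close> lies.\<close>

lemma tail_neighbourhood: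
  assumes "compact_space X" "ray_continuous X g"
    and "\<And>x. x \<in> topspace X \<Longrightarrow> g x < g p \<or> x = p"
    and "\<exists>j. j < g p" and V: "openin X V" "p \<in> V"
  shows "\<exists>j<g p. \<forall>x\<in>topspace X. j < g x \<longrightarrow> x \<in> V"
proof (rule ccontr)
  assume no: "\<not> ?thesis"
  have "\<exists>x\<in>topspace X - V. g x = g p"
  proof (rule fibre_limit[OF assms(1,2)])
    show "closedin X (topspace X - V)"
      using V by blast
    show "\<exists>x\<in>topspace X - V. j < g x \<and> g x \<le> g p" if "j < g p" for j
      using no that assms(3) by (metis DiffI less_imp_le order_refl)
  qed (rule assms(4))
  then show False
    using assms(3) V(2) by fastforce
qed

context regular_limit
begin

text \<open>Call a point of the fibre over \<open>i\<close> essential if it is a limit of points lying over ordinals below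
  \<open>i\<close>. Cleave along the set \<open>A\<close> of \<open>xh\<close> and one essential point from each fibre over \<open>W\<close>. As the
  complement of \<open>W\<close> is stationary, the cleaving map \<open>f\<close> cannot take the value \<open>f xh\<close> in unboundedly
  many fibres, so near \<open>xh\<close> it is increasing from fibre to fibre, at least across a club. In the
  fibres over this club the essential points are then minimum points of \<open>f\<close>, and by
  the choice of \<open>A\<close> the minimum is attained only once.\<close>
lemma almost_clopen_fibres:
  fixes X :: "'a topology" and g :: "'a \<Rightarrow> 'c"
  assumes X: "compact_space X" and g: "ray_continuous X g"
    and cleave: "\<And>A. A \<subseteq> topspace X \<Longrightarrow>
      \<exists>f :: 'a \<Rightarrow> 'd::wellorder. ray_continuous X f \<and> cleaves_along X f A"
    and xh: "xh \<in> topspace X" "g xh = \<alpha>"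
    and below: "\<And>x. x \<in> topspace X \<Longrightarrow> x \<noteq> xh \<Longrightarrow> g x < \<alpha>"
    and W: "stationary (- W)"
  shows "\<exists>F. maps_below F \<and> (\<forall>i<\<alpha>. closure_point F i \<longrightarrow> i \<in> W \<longrightarrow>
    (\<exists>s. openin X ({x \<in> topspace X. g x = i} - {s}) \<and> closedin X ({x \<in> topspace X. g x = i} - {s})))"
proof -
  \<comment> \<open>\<open>L i\<close> collects the essential points over \<open>i\<close>, and
    \<open>s i\<close> selects one of them.\<close>
  define L where "L i = {x \<in> topspace X. g x = i} \<inter> X closure_of {x \<in> topspace X. g x < i}" for i
  define s where "s i = (SOME x. x \<in> L i)" for i
  have s: "s i \<in> L i" if "L i \<noteq> {}" for i
    unfolding s_def using that by (simp add: some_in_eq)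
  have gL: "g x = i" "x \<in> topspace X" if "x \<in> L i" for x i
    using that by (auto simp: L_def)
  define A where "A = insert xh {s i | i. i < \<alpha> \<and> i \<in> W \<and> L i \<noteq> {}}"
  have "A \<subseteq> topspace X"
    using xh(1) gL(2)[OF s] by (auto simp: A_def)
  then obtain f :: "'a \<Rightarrow> 'd" where f: "ray_continuous X f" and "cleaves_along X f A"
    using cleave by blast
  then have sep: "f x \<noteq> f y" if "x \<in> A" "y \<in> topspace X" "y \<notin> A" for x y
    using that by (auto simp: cleaves_along_def)
  have A_fibre: "x = s (g x) \<and> g x \<in> W" if x: "x \<in> A" "x \<noteq> xh" for x
  proof -
    obtain i where i: "x = s i" "i \<in> W" "L i \<noteq> {}"
      using x by (auto simp: A_def)
    then have "g x = i"
      using gL(1)[OF s] by blast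
    then show ?thesis
      using i by simp
  qed
  define \<eta> where "\<eta> = f xh"
  have tail: "\<exists>j<\<alpha>. \<forall>x\<in>topspace X. j < g x \<longrightarrow> x \<in> V" if "openin X V" "xh \<in> V" for V
    using tail_neighbourhood[OF X g, of xh V] below nonempty that xh(2) by auto
  \<comment> \<open>Otherwise some \<open>x j\<close> with value \<open>\<eta>\<close> lies beyond
    each \<open>j\<close>. At a closure point \<open>i\<close> outside \<open>W\<close>,
    \<open>fibre_limit\<close> gives a point over \<open>i\<close> with value \<open>f xh\<close>.
    Cleaving forces it into \<open>A\<close>, but apart from \<open>xh\<close> all points of
    \<open>A\<close> lie over \<open>W\<close>.\<close>
  have "\<exists>j<\<alpha>. \<forall>x\<in>topspace X. x \<noteq> xh \<and> j < g x \<longrightarrow> f x \<noteq> \<eta>"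
  proof (rule ccontr)
    assume "\<not> ?thesis"
    then obtain x where x: "\<And>j. j < \<alpha> \<Longrightarrow> x j \<in> topspace X \<and> x j \<noteq> xh \<and> j < g (x j) \<and> f (x j) = \<eta>"
      by metis
    have "maps_below (\<lambda>j. g (x j))"
      using x below by (simp add: maps_below_def)
    then obtain i where i: "i < \<alpha>" "closure_point (\<lambda>j. g (x j)) i" "i \<notin> W"
      using W unfolding stationary_def by blast
    have "\<exists>z\<in>{x \<in> topspace X. f x = \<eta>}. g z = i"
    proof (rule fibre_limit[OF X g])
      show "closedin X {x \<in> topspace X. f x = \<eta>}"
        by (rule ray_continuous_fibre_closedin[OF f])
      show "\<exists>j. j < i"
        using i(2) by (simp add: closure_point_def)
      fix j assume "j < i"
      then show "\<exists>z\<in>{x \<in> topspace X. f x = \<eta>}. j < g z \<and> g z \<le> i"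
        using x[of j] i(1,2) by (intro bexI[of _ "x j"]) (auto simp: closure_point_def less_imp_le)
    qed
    then obtain z where z: "z \<in> topspace X" "f z = \<eta>" "g z = i"
      by blast
    then have "z \<in> A"
      using sep[of xh z] by (auto simp: A_def \<eta>_def)
    moreover have "z \<noteq> xh"
      using z(3) i(1) xh(2) by auto
    ultimately show False
      using A_fibre z(3) i(3) by blast
  qed
  then obtain j1 where j1: "j1 < \<alpha>" "\<And>x. x \<in> topspace X \<Longrightarrow> x \<noteq> xh \<Longrightarrow> j1 < g x \<Longrightarrow> f x \<noteq> \<eta>"
    by blast
  obtain j2 where j2: "j2 < \<alpha>" "\<And>x. x \<in> topspace X \<Longrightarrow> j2 < g x \<Longrightarrow> f x \<le> \<eta>"
    using tail[OF ray_continuous_openin_le[OF f, of \<eta>]] xh(1) by (auto simp: \<eta>_def)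
  define j0 where "j0 = max j1 j2"
  have j0: "j0 < \<alpha>"
    using j1(1) j2(1) by (simp add: j0_def)
  have lt: "f x < \<eta>" if "x \<in> topspace X" "x \<noteq> xh" "j0 < g x" for x
    using le_neq_trans[OF j2(2) j1(2)] that by (simp add: j0_def)
  \<comment> \<open>On the compact set \<open>K\<close> over \<open>(j0, j]\<close>,
    \<open>fibre_limit\<close> for \<open>f\<close> gives a bound \<open>b < \<eta>\<close>; near
    \<open>xh\<close> the values exceed \<open>b\<close>.\<close>
  have "\<exists>k<\<alpha>. \<forall>x\<in>topspace X. \<forall>y\<in>topspace X. j0 < g x \<and> g x \<le> j \<and> k < g y \<longrightarrow> f x < f y"
    if j: "j < \<alpha>" for j
  proof (cases "\<exists>x\<in>topspace X. j0 < g x \<and> g x \<le> j")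
    case False
    then show ?thesis
      using j by blast
  next
    case True
    define K where "K = {x \<in> topspace X. g x \<le> j} \<inter> (topspace X - {x \<in> topspace X. g x \<le> j0})"
    have K: "x \<in> K \<longleftrightarrow> x \<in> topspace X \<and> j0 < g x \<and> g x \<le> j" for x
      by (auto simp: K_def)
    have "x \<noteq> xh" if "x \<in> K" for x
      using that j xh(2) by (auto simp: K)
    then have f_lt: "f x < \<eta>" if "x \<in> K" for x
      using that lt by (auto simp: K)
    have "closedin X K"
      unfolding K_def
      by (intro closedin_Int closedin_diff closedin_topspace ray_continuous_closedin[OF g]
          ray_continuous_openin_le[OF g])
    moreover have "\<exists>b. b < \<eta>"
      using True f_lt K by blast
    moreover have "\<not> (\<exists>x\<in>K. f x = \<eta>)"
      using f_lt by auto
    ultimately obtain b where b: "b < \<eta>" "\<And>x. x \<in> K \<Longrightarrow> \<not> (b < f x \<and> f x \<le> \<eta>)"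
      using fibre_limit[OF X f, of K \<eta>] by blast
    have "openin X {x \<in> topspace X. b < f x}"
      using f by (simp add: ray_continuous_def)
    then obtain k where k: "k < \<alpha>" "\<And>y. y \<in> topspace X \<Longrightarrow> k < g y \<Longrightarrow> b < f y"
      using tail[of "{x \<in> topspace X. b < f x}"] xh(1) b(1) by (auto simp: \<eta>_def)
    have "f x < f y" if "x \<in> K" "y \<in> topspace X" "k < g y" for x y
      using b(2)[OF that(1)] f_lt[OF that(1)] k(2)[OF that(2,3)] by (auto simp: not_less less_imp_le)
    then show ?thesis
      using k(1) K by blast
  qed
  then obtain F where F: "\<And>j. j < \<alpha> \<Longrightarrow> F j < \<alpha>"
      "\<And>j x y. j < \<alpha> \<Longrightarrow> x \<in> topspace X \<Longrightarrow> y \<in> topspace X \<Longrightarrow> j0 < g x \<Longrightarrow> g x \<le> j \<Longrightarrow> F j < g y \<Longrightarrow> f x < f y"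
    by metis
  have "maps_below (\<lambda>j. max (F j) j0)"
    using F(1) j0 by (simp add: maps_below_def)
  moreover have "\<exists>s. openin X ({x \<in> topspace X. g x = i} - {s}) \<and> closedin X ({x \<in> topspace X. g x = i} - {s})"
    if i: "i < \<alpha>" "closure_point (\<lambda>j. max (F j) j0) i" "i \<in> W" for i
  proof -
    let ?X = "{x \<in> topspace X. g x = i}" and ?C = "X closure_of {x \<in> topspace X. g x < i}"
    have "{x \<in> topspace X. g x < i} \<subseteq> ?C"
      by (intro closure_of_subset) auto
    \<comment> \<open>Points outside the closure of the lower fibres form an open set, and so does
      the region up to \<open>i\<close>; hence the non-essential part of the fibre is open.\<close>
    then have diff: "?X - L i = {x \<in> topspace X. g x \<le> i} \<inter> (topspace X - ?C)"
      by (fastforce simp: L_def less_le)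
    have open_diff: "openin X (?X - L i)"
      unfolding diff
      by (intro openin_Int openin_diff openin_topspace closedin_closure_of ray_continuous_openin_le[OF g])
    show ?thesis
    proof (cases "L i = {}")
      case True
      \<comment> \<open>\<open>xh\<close> lies outside this fibre, so deleting it changes
        nothing.\<close>
      have "?X - {xh} = ?X - L i"
        using True i(1) xh(2) by auto
      then show ?thesis
        using open_diff ray_continuous_fibre_closedin[OF g, of i] True
        by (intro exI[of _ xh]) simp
    next
      case False
      then have sL: "s i \<in> L i"
        by (rule s)
      have "j0 < i" and cp: "\<And>j. j < i \<Longrightarrow> F j < i"
        using i(2) by (auto simp: closure_point_def)
      \<comment> \<open>An essential \<open>y\<close> is a limit of points over
        \<open>(j0, i)\<close>, and there \<open>f\<close> is smaller than anywhere on the fibre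
        over the closure point \<open>i\<close>.\<close>
      have min: "f y \<le> f z" if y: "y \<in> L i" and z: "z \<in> ?X" for y z
      proof (rule ccontr)
        assume "\<not> f y \<le> f z"
        define T where "T = {x \<in> topspace X. f z < f x} \<inter> {x \<in> topspace X. j0 < g x}"
        have "y \<in> T"
          using \<open>\<not> f y \<le> f z\<close> gL[OF y] \<open>j0 < i\<close> by (simp add: T_def)
        moreover have "openin X T"
          unfolding T_def using f g by (intro openin_Int) (simp_all add: ray_continuous_def)
        moreover have "y \<in> ?C"
          using y by (simp add: L_def)
        ultimately have "\<exists>x. x \<in> {x \<in> topspace X. g x < i} \<and> x \<in> T"
          unfolding in_closure_of by simp
        then obtain x where x: "x \<in> topspace X" "g x < i" "f z < f x" "j0 < g x"
          by (auto simp: T_def)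
        then have "f x < f z"
          using F(2)[of "g x" x z] cp[of "g x"] z i(1) by auto
        then show False
          using x(3) by simp
      qed
      have sA: "s i \<in> A"
        using i(1,3) False by (auto simp: A_def)
      have notA: "z \<notin> A" if "z \<in> ?X" "z \<noteq> s i" for z
        using A_fibre[of z] that i(1) xh(2) by auto
      \<comment> \<open>Within the fibre only \<open>s i\<close> is in \<open>A\<close>, so cleaving
        rules out equality.\<close>
      have gt: "f (s i) < f z" if "z \<in> ?X" "z \<noteq> s i" for z
        using min[OF sL that(1)] sep[OF sA, of z] notA[OF that] that(1) by (auto simp: less_le)
      have "L i = {s i}"
      proof -
        have "y = s i" if "y \<in> L i" for y
          using gt[of y] min[OF that, of "s i"] gL[OF that] gL[OF sL] by (fastforce simp: not_less)
        then show ?thesis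
          using sL by blast
      qed
      then have "openin X (?X - {s i})"
        using open_diff by simp
      \<comment> \<open>As a strict minimum, \<open>s i\<close> is cut off by a ray of
        \<open>f\<close>, which makes the rest of the fibre closed.\<close>
      moreover have diff': "?X - {s i} = ?X \<inter> (topspace X - {x \<in> topspace X. f x \<le> f (s i)})"
        using gt not_le by blast
      have "closedin X (?X - {s i})"
        unfolding diff'
        by (intro closedin_Int closedin_diff closedin_topspace ray_continuous_fibre_closedin[OF g]
            ray_continuous_openin_le[OF f])
      ultimately show ?thesis
        by blast
    qed
  qed
  ultimately show ?thesis
    by blast
qed

text \<open>The initial segments \<open>V d\<close> cut the space into blocks. The clopen part of the fibre over \<open>d\<close> is left to the
  block after \<open>d\<close>, so that a block ending at a limit of closure points is a singleton and every
  other block is clopen.\<close>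
lemma wo_space_of_closure_points:
  fixes X :: "'a topology" and g :: "'a \<Rightarrow> 'c"
  assumes g: "ray_continuous X g"
    and xh: "xh \<in> topspace X" "g xh = \<alpha>"
    and below: "\<And>x. x \<in> topspace X \<Longrightarrow> x \<noteq> xh \<Longrightarrow> g x < \<alpha>"
    and clopen: "\<And>C. openin X C \<Longrightarrow> closedin X C \<Longrightarrow> xh \<notin> C \<Longrightarrow> wo_space (subtopology X C)"
    and F: "maps_below F"
    and good: "\<And>i. i < \<alpha> \<Longrightarrow> closure_point F i \<Longrightarrow>
      \<exists>s. openin X ({x \<in> topspace X. g x = i} - {s}) \<and> closedin X ({x \<in> topspace X. g x = i} - {s})"
  shows "wo_space X"
proof -
  define clopen_in where "clopen_in C \<longleftrightarrow> openin X C \<and> closedin X C" for C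
  define s where "s i = (SOME s. clopen_in ({x \<in> topspace X. g x = i} - {s}))" for i
  have "clopen_in ({x \<in> topspace X. g x = i} - {s i})" if "i < \<alpha>" "closure_point F i" for i
    unfolding s_def by (rule someI_ex) (use good[OF that] in \<open>simp add: clopen_in_def\<close>)
  then have s: "openin X ({x \<in> topspace X. g x = i} - {s i})"
      "closedin X ({x \<in> topspace X. g x = i} - {s i})" if "i < \<alpha>" "closure_point F i" for i
    using that by (simp_all add: clopen_in_def)
  define D where "D = insert \<alpha> {i. i < \<alpha> \<and> closure_point F i}"
  \<comment> \<open>From the fibre over \<open>d < \<alpha>\<close> at most \<open>s d\<close> is
    kept; the removed part is clopen, so \<open>V d\<close> is clopen too.\<close>
  define V where "V d = (if d < \<alpha> then {x \<in> topspace X. g x \<le> d} - ({x \<in> topspace X. g x = d} - {s d})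
      else topspace X)" for d
  have V_open: "openin X (V d)" and V_closed: "closedin X (V d)" if "d \<in> D" for d
  proof -
    have "openin X (V d) \<and> closedin X (V d)"
    proof (cases "d < \<alpha>")
      case True
      then have "closure_point F d"
        using that by (auto simp: D_def)
      then have "openin X ({x \<in> topspace X. g x \<le> d} - ({x \<in> topspace X. g x = d} - {s d}))"
          "closedin X ({x \<in> topspace X. g x \<le> d} - ({x \<in> topspace X. g x = d} - {s d}))"
        using s True ray_continuous_openin_le[OF g] ray_continuous_closedin[OF g]
        by blast+
      then show ?thesis
        using True by (simp add: V_def)
    qed (simp add: V_def)
    then show "openin X (V d)" "closedin X (V d)"
      by simp_all
  qed
  have V_iff: "x \<in> V d \<longleftrightarrow> x \<in> topspace X \<and> (g x < d \<or> g x = d \<and> x = s d)" if "d < \<alpha>" for x d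
    using that by (auto simp: V_def less_le)
  have V_mono: "V d \<subseteq> V e" if "d < e" "e \<in> D" for d e
  proof (cases "e < \<alpha>")
    case True
    then have "d < \<alpha>" using that(1) by simp
    then show ?thesis
      using that(1) by (auto simp: V_iff True)
  qed (auto simp: V_def)
  have D_le: "d \<le> \<alpha>" if "d \<in> D" for d
    using that by (auto simp: D_def)
  define h where "h x = (LEAST d. d \<in> D \<and> x \<in> V d)" for x
  have h: "h x \<in> D" "x \<in> V (h x)" and h_le: "\<And>d. d \<in> D \<Longrightarrow> x \<in> V d \<Longrightarrow> h x \<le> d"
    if "x \<in> topspace X" for x
  proof -
    have ex: "\<alpha> \<in> D \<and> x \<in> V \<alpha>"
      using that by (simp add: D_def V_def)
    show "h x \<in> D" "x \<in> V (h x)"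
      using LeastI[of "\<lambda>d. d \<in> D \<and> x \<in> V d", OF ex] by (simp_all add: h_def)
    show "h x \<le> d" if "d \<in> D" "x \<in> V d" for d
      unfolding h_def using that by (intro Least_le) simp
  qed
  have h_xh: "h xh = \<alpha>"
  proof (rule antisym)
    show "h xh \<le> \<alpha>"
      using D_le h(1)[OF xh(1)] by blast
    show "\<alpha> \<le> h xh"
    proof (rule ccontr)
      assume "\<not> \<alpha> \<le> h xh"
      then show False
        using h(2)[OF xh(1)] V_iff[of "h xh" xh] xh(2) by auto
    qed
  qed
  have less_union: "{x \<in> topspace X. h x < c} = \<Union> (V ` {d \<in> D. d < c})" for c
  proof (intro equalityI subsetI)
    fix x assume "x \<in> {x \<in> topspace X. h x < c}"
    then show "x \<in> \<Union> (V ` {d \<in> D. d < c})"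
      using h[of x] by auto
  next
    fix x assume "x \<in> \<Union> (V ` {d \<in> D. d < c})"
    then obtain d where d: "d \<in> D" "d < c" "x \<in> V d"
      by blast
    then have "x \<in> topspace X"
      by (auto simp: V_def split: if_splits)
    then show "x \<in> {x \<in> topspace X. h x < c}"
      using h_le[OF _ d(1,3)] d(2) by simp
  qed
  have less_open: "openin X {x \<in> topspace X. h x < c}" for c
    unfolding less_union using V_open by (intro openin_Union) auto
  have le_clopen: "openin X {x \<in> topspace X. h x \<le> c} \<and> closedin X {x \<in> topspace X. h x \<le> c}" for c
  proof -
    consider "\<alpha> \<le> c" | "c < \<alpha>" "\<forall>d\<in>D. \<not> d \<le> c" | "c < \<alpha>" "\<exists>d\<in>D. d \<le> c"
      by fastforce
    then show ?thesis
    proof cases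
      case 1
      then have "{x \<in> topspace X. h x \<le> c} = topspace X"
        using h(1) D_le by (auto intro: order_trans)
      then show ?thesis
        by simp
    next
      case 2
      then have "{x \<in> topspace X. h x \<le> c} = {}"
        using h(1) by auto
      then show ?thesis
        by (simp only: openin_empty closedin_empty)
    next
      case 3
      \<comment> \<open>The supremum of the elements of \<open>D\<close> up to \<open>c\<close>. It
        is a closure point, hence in \<open>D\<close>, and the cut of \<open>h\<close> at
        \<open>c\<close> is \<open>V e\<close>.\<close>
      define e where "e = (LEAST e. \<forall>d\<in>D. d \<le> c \<longrightarrow> d \<le> e)"
      have e: "\<forall>d\<in>D. d \<le> c \<longrightarrow> d \<le> e"
        unfolding e_def by (rule LeastI[of _ c]) simp
      have "e \<le> c"
        unfolding e_def by (rule Least_le) simp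
      have acc: "\<exists>d\<in>D. d \<le> c \<and> j < d" if "j < e" for j
        using not_less_Least[of j "\<lambda>e. \<forall>d\<in>D. d \<le> c \<longrightarrow> d \<le> e"] that
        unfolding e_def by (auto simp: not_le)
      have cp: "closure_point F d" if "d \<in> D" "d \<le> c" for d
        using that 3(1) by (auto simp: D_def)
      have "closure_point F e"
        unfolding closure_point_def
      proof (intro conjI allI impI)
        obtain d where d: "d \<in> D" "d \<le> c"
          using 3(2) by blast
        then have "\<exists>j. j < d"
          using cp by (simp add: closure_point_def)
        then show "\<exists>j. j < e"
          using e d by (meson less_le_trans)
        fix j assume "j < e"
        then obtain d where d: "d \<in> D" "d \<le> c" "j < d"
          using acc by blast
        then have "F j < d"
          using cp by (simp add: closure_point_def)
        then show "F j < e"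
          using e d by (meson less_le_trans)
      qed
      then have "e \<in> D"
        using \<open>e \<le> c\<close> 3(1) by (auto simp: D_def)
      have "{x \<in> topspace X. h x \<le> c} = V e"
      proof (intro equalityI subsetI)
        fix x assume x: "x \<in> {x \<in> topspace X. h x \<le> c}"
        then have "h x \<le> e"
          using e h(1) by blast
        then show "x \<in> V e"
          using h(2)[of x] V_mono[OF _ \<open>e \<in> D\<close>, of "h x"] x unfolding le_less by auto
      next
        fix x assume x: "x \<in> V e"
        then have "x \<in> topspace X"
          by (auto simp: V_def split: if_splits)
        then show "x \<in> {x \<in> topspace X. h x \<le> c}"
          using h_le[OF _ \<open>e \<in> D\<close> x] \<open>e \<le> c\<close> by auto
      qed
      then show ?thesis
        using V_open V_closed \<open>e \<in> D\<close> by simp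
    qed
  qed
  show ?thesis
  proof (rule wo_space_fibrewise)
    have greater: "{x \<in> topspace X. c < h x} = topspace X - {x \<in> topspace X. h x \<le> c}" for c
      by auto
    show "ray_continuous X h"
      unfolding ray_continuous_def greater
      by (intro allI conjI less_open openin_diff openin_topspace le_clopen[THEN conjunct2])
    fix c
    let ?H = "{x \<in> topspace X. h x = c}"
    show "(\<exists>p. ?H \<subseteq> {p}) \<or> openin X ?H \<and> wo_space (subtopology X ?H)"
    proof (cases "\<exists>e<c. \<forall>d\<in>D. d < c \<longrightarrow> d \<le> e")
      case True
      then obtain e where e: "e < c" "\<And>d. d \<in> D \<Longrightarrow> d < c \<Longrightarrow> d \<le> e"
        by blast
      \<comment> \<open>Closure points are unbounded in \<open>\<alpha>\<close>, so no
        \<open>e < \<alpha>\<close> bounds those elements of \<open>D\<close> below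
        \<open>\<alpha>\<close>.\<close>
      have "c \<noteq> \<alpha>"
      proof
        assume "c = \<alpha>"
        then obtain i where "i < \<alpha>" "e < i" "closure_point F i"
          using closure_point_above[OF F] e(1) by blast
        then show False
          using e(2)[of i] \<open>c = \<alpha>\<close> by (auto simp: D_def)
      qed
      have H: "?H = {x \<in> topspace X. h x \<le> c} - {x \<in> topspace X. h x \<le> e}"
        using e h(1) by (force simp: less_le)
      have "openin X ?H" "closedin X ?H"
        unfolding H using le_clopen by blast+
      moreover have "xh \<notin> ?H"
        using h_xh \<open>c \<noteq> \<alpha>\<close> by simp
      ultimately show ?thesis
        using clopen by blast
    next
      case False
      \<comment> \<open>Any other point of \<open>V c\<close> has \<open>g x < c\<close>, and then
        already lies in \<open>V d\<close> for some \<open>d < c\<close> in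
        \<open>D\<close>.\<close>
      have "x = (if c = \<alpha> then xh else s c)" if x: "x \<in> topspace X" "h x = c" for x
      proof (rule ccontr)
        assume neq: "x \<noteq> (if c = \<alpha> then xh else s c)"
        have "c \<in> D" "x \<in> V c"
          using h[OF x(1)] x(2) by simp_all
        then have "g x < c"
          using neq below[OF x(1)] V_iff[of c x] D_le[of c] by (cases "c = \<alpha>") auto
        then obtain d where d: "d \<in> D" "d < c" "g x < d"
          using False by (auto simp: not_le)
        then have "x \<in> V d"
          using V_iff[of d x] D_le[OF \<open>c \<in> D\<close>] x(1) by auto
        then show False
          using h_le[OF x(1) d(1)] d(2) x(2) by auto
      qed
      then show ?thesis
        by blast
    qed
  qed
qed

end

section \<open>Well-ordering around a point\<close>

definition peaks_at :: "'a topology \<Rightarrow> 'a \<Rightarrow> 'c::wellorder \<Rightarrow> ('a \<Rightarrow> 'c) \<Rightarrow> bool" where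
  "peaks_at X xh \<alpha> g \<longleftrightarrow> ray_continuous X g \<and> g xh = \<alpha> \<and> (\<forall>x\<in>topspace X. x \<noteq> xh \<longrightarrow> g x < \<alpha>)"

lemma cleaves_along_singleton:
  assumes "cleaves_along X f {p}" "x \<in> topspace X" "x \<noteq> p"
  shows "f x \<noteq> f p"
proof
  assume "f x = f p"
  then have "f p \<in> f ` {p} \<inter> f ` (topspace X - {p})"
    using assms(2,3) by (auto intro: image_eqI[of _ f x])
  then show False
    using assms(1) by (simp add: cleaves_along_def)
qed

text \<open>Values above \<open>f xh\<close> are reset to the least element \<open>b\<close>. They
  occur on a clopen set, so continuity survives; \<open>b\<close> differs from \<open>f xh\<close>
  because \<open>xh\<close> is not isolated.\<close>

lemma ex_peaks_at:
  fixes f :: "'a \<Rightarrow> 'c::wellorder"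
  assumes f: "ray_continuous X f" "cleaves_along X f {xh}" and xh: "xh \<in> topspace X"
    and limit: "\<not> openin X {xh}"
  shows "\<exists>g. peaks_at X xh (f xh) g"
proof -
  have neq: "f x \<noteq> f xh" if "x \<in> topspace X" "x \<noteq> xh" for x
    using cleaves_along_singleton[OF f(2) that] .
  define b :: 'c where "b = (LEAST b. True)"
  have b: "b \<le> y" for y
    unfolding b_def by (rule Least_le) simp
  have "b \<noteq> f xh"
  proof
    assume "b = f xh"
    then have "{x \<in> topspace X. f x \<le> f xh} = {xh}"
      using b neq xh by (auto intro: antisym)
    then show False
      using limit ray_continuous_openin_le[OF f(1), of "f xh"] by simp
  qed
  then have b_less: "b < f xh"
    using b by (simp add: less_le)
  define g where "g x = (if f x \<le> f xh then f x else b)" for x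
  have "openin X {x \<in> topspace X. g x < c}" "openin X {x \<in> topspace X. c < g x}" for c
  proof -
    have "{x \<in> topspace X. g x < c} = {x \<in> topspace X. f x \<le> f xh} \<inter> {x \<in> topspace X. f x < c}
        \<union> (if b < c then {x \<in> topspace X. f xh < f x} else {})"
      by (auto simp: g_def not_le)
    then show "openin X {x \<in> topspace X. g x < c}"
      using f(1) ray_continuous_openin_le[OF f(1)]
      by (simp add: ray_continuous_def openin_Un openin_Int)
    have "{x \<in> topspace X. c < g x} = {x \<in> topspace X. f x \<le> f xh} \<inter> {x \<in> topspace X. c < f x}"
      using b by (auto simp: g_def not_less[symmetric])
    then show "openin X {x \<in> topspace X. c < g x}"
      using f(1) ray_continuous_openin_le[OF f(1)] by (auto simp: ray_continuous_def)
  qed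
  moreover have "g x < f xh" if "x \<in> topspace X" "x \<noteq> xh" for x
    using neq[OF that] b_less by (auto simp: g_def)
  ultimately have "peaks_at X xh (f xh) g"
    by (simp add: peaks_at_def ray_continuous_def) (simp add: g_def)
  then show ?thesis
    by blast
qed

text \<open>If \<open>j\<close> were the predecessor of \<open>\<alpha>\<close>, the open ray above
  \<open>j\<close> would have preimage \<open>{xh}\<close>.\<close>

lemma peaks_at_limit:
  assumes g: "peaks_at X xh \<alpha> g" and limit: "\<not> openin X {xh}" and xh: "xh \<in> topspace X"
    and j: "j < \<alpha>"
  shows "\<exists>k>j. k < \<alpha>"
proof (rule ccontr)
  assume "\<not> ?thesis"
  then have "{x \<in> topspace X. j < g x} = {xh}"
    using g j xh by (auto simp: peaks_at_def)
  then show False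
    using limit g unfolding peaks_at_def ray_continuous_def by metis
qed

text \<open>If \<open>F\<close> maps the ordinals below \<open>j\<close> cofinally into \<open>\<alpha>\<close>, then collapsing the intervals
  between its running suprema lowers the peak of \<open>g\<close> from \<open>\<alpha>\<close> to \<open>j\<close>.\<close>
lemma peaks_at_regular:
  fixes \<alpha> :: "'c::wellorder"
  assumes g: "peaks_at X xh \<alpha> g"
    and least: "\<And>\<beta> g :: 'a \<Rightarrow> 'c. \<beta> < \<alpha> \<Longrightarrow> \<not> peaks_at X xh \<beta> g"
    and xh: "xh \<in> topspace X"
    and "j < \<alpha>" "\<And>i. i < j \<Longrightarrow> F i < \<alpha>"
  shows "\<exists>b<\<alpha>. \<forall>i<j. F i \<le> b"
  using assms(4,5)
proof (induction j arbitrary: F rule: less_induct)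
  case (less j)
  show ?case
  proof (rule ccontr)
    assume no: "\<not> ?thesis"
    have cofinal: "\<exists>i<j. b < F i" if "b < \<alpha>" for b
      using no that by (auto simp: not_le)
    \<comment> \<open>The induction hypothesis at \<open>c\<close> keeps the running suprema below
      \<open>\<alpha>\<close>.\<close>
    have bound: "\<exists>b<\<alpha>. \<forall>i\<le>c. F i \<le> b" if c: "c < j" for c
    proof -
      obtain b where b: "b < \<alpha>" "\<forall>i<c. F i \<le> b"
        using less.IH[of c F] less.prems c by (meson less_trans)
      have "F i \<le> max b (F c)" if "i \<le> c" for i
        using b(2) that by (cases "i = c") (simp_all add: le_max_iff_disj less_le)
      then show ?thesis
        using b(1) less.prems(2)[OF c] by (intro exI[of _ "max b (F c)"]) simp
    qed
    define S where "S c = (LEAST b. \<forall>i\<le>c. F i \<le> b)" for c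
    have S: "S c < \<alpha>" "F c \<le> S c" if c: "c < j" for c
    proof -
      obtain b where b: "b < \<alpha>" "\<forall>i\<le>c. F i \<le> b"
        using bound c by blast
      show "S c < \<alpha>"
        unfolding S_def using Least_le[of "\<lambda>b. \<forall>i\<le>c. F i \<le> b" b] b by simp
      show "F c \<le> S c"
        unfolding S_def using LeastI[of "\<lambda>b. \<forall>i\<le>c. F i \<le> b" b] b by simp
    qed
    have S_mono: "S c \<le> S d" if "c \<le> d" "d < j" for c d
    proof -
      obtain b where b: "\<forall>i\<le>d. F i \<le> b"
        using bound \<open>d < j\<close> by blast
      have "\<forall>i\<le>d. F i \<le> S d"
        unfolding S_def using LeastI[of "\<lambda>b. \<forall>i\<le>d. F i \<le> b" b] b by simp
      then show ?thesis
        unfolding S_def[of c] using \<open>c \<le> d\<close> by (intro Least_le) (auto intro: order_trans)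
    qed
    \<comment> \<open>The first stage whose supremum reaches \<open>g x\<close>; no stage below
      \<open>j\<close> reaches \<open>\<alpha>\<close>, so \<open>xh\<close> gets the new peak
      \<open>j\<close>.\<close>
    define h where "h x = (if x = xh then j else LEAST i. g x \<le> S i)" for x
    have g_le: "g x \<le> S (h x)" and h_less: "h x < j" if x: "x \<in> topspace X" "x \<noteq> xh" for x
    proof -
      have "g x < \<alpha>"
        using g x by (simp add: peaks_at_def)
      then obtain i where i: "i < j" "g x < F i"
        using cofinal by blast
      then have le: "g x \<le> S i"
        using S(2)[OF i(1)] by simp
      show "g x \<le> S (h x)"
        unfolding h_def using LeastI[of "\<lambda>i. g x \<le> S i", OF le] x(2) by simp
      show "h x < j"
        unfolding h_def using Least_le[of "\<lambda>i. g x \<le> S i", OF le] x(2) i(1) by simp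
    qed
    have h_le: "h x \<le> c \<longleftrightarrow> g x \<le> S c" if x: "x \<in> topspace X" and c: "c < j" for x c
    proof (cases "x = xh")
      case True
      have "g xh = \<alpha>"
        using g by (simp add: peaks_at_def)
      then show ?thesis
        using True c S(1)[OF c] by (simp add: h_def not_le[symmetric])
    next
      case False
      show ?thesis
      proof
        assume "h x \<le> c"
        then show "g x \<le> S c"
          using g_le[OF x False] S_mono[OF _ c] order_trans by blast
      next
        assume "g x \<le> S c"
        then show "h x \<le> c"
          unfolding h_def using False by (simp add: Least_le)
      qed
    qed
    have gc: "ray_continuous X g"
      using g by (simp add: peaks_at_def)
    have "openin X {x \<in> topspace X. h x < c}" for c
    proof (cases "j < c")
      case True
      have "h x < c" if "x \<in> topspace X" for x
        using h_less[OF that] True by (cases "x = xh") (auto simp: h_def)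
      then have "{x \<in> topspace X. h x < c} = topspace X"
        by blast
      then show ?thesis
        by simp
    next
      case False
      have "h x < c \<longleftrightarrow> (\<exists>i<c. g x \<le> S i)" if x: "x \<in> topspace X" for x
      proof -
        have "h x < c \<longleftrightarrow> (\<exists>i<c. h x \<le> i)"
          by (blast intro: le_less_trans)
        also have "\<dots> \<longleftrightarrow> (\<exists>i<c. g x \<le> S i)"
          using h_le[OF x] less_le_trans[OF _ False[unfolded not_less]] by blast
        finally show ?thesis .
      qed
      then have "{x \<in> topspace X. h x < c} = (\<Union>i\<in>{..<c}. {x \<in> topspace X. g x \<le> S i})"
        by auto
      then show ?thesis
        using ray_continuous_openin_le[OF gc] by auto
    qed
    moreover have "openin X {x \<in> topspace X. c < h x}" for c
    proof (cases "c < j")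
      case True
      then have "{x \<in> topspace X. c < h x} = {x \<in> topspace X. S c < g x}"
        using h_le by (auto simp: not_le[symmetric])
      then show ?thesis
        using gc by (simp add: ray_continuous_def)
    next
      case False
      have "\<not> c < h x" if "x \<in> topspace X" for x
        using h_less[OF that] False by (cases "x = xh") (auto simp: h_def)
      then have "{x \<in> topspace X. c < h x} = {}"
        by blast
      then show ?thesis
        by (simp only: openin_empty)
    qed
    ultimately have "peaks_at X xh j h"
      using h_less by (simp add: peaks_at_def ray_continuous_def) (simp add: h_def)
    then show False
      using least less.prems(1) by blast
  qed
qed

text \<open>Carries well-orderability across one exceptional point. The cases: \<open>xh\<close> is
  isolated, its least peak is \<omega>, or its least peak is regular and uncountable.\<close>

lemma wo_space_at_point:
  fixes X :: "'a topology"
  assumes X: "compact_space X"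
    and cleave: "\<And>A. A \<subseteq> topspace X \<Longrightarrow>
      \<exists>f :: 'a \<Rightarrow> 'c::wellorder. ray_continuous X f \<and> cleaves_along X f A"
    and xh: "xh \<in> topspace X"
    and clopen: "\<And>C. openin X C \<Longrightarrow> closedin X C \<Longrightarrow> xh \<notin> C \<Longrightarrow> wo_space (subtopology X C)"
  shows "wo_space X"
proof (cases "openin X {xh}")
  case True
  obtain f :: "'a \<Rightarrow> 'c" where f: "ray_continuous X f" "cleaves_along X f {xh}"
    using cleave[of "{xh}"] xh by auto
  have "{x \<in> topspace X. f x = f xh} = {xh}"
    using cleaves_along_singleton[OF f(2)] xh by blast
  then have "closedin X {xh}"
    using ray_continuous_fibre_closedin[OF f(1), of "f xh"] by simp
  moreover have "wo_space (subtopology X {xh})"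
    by (rule wo_space_subsingleton[of _ xh]) simp
  moreover have "wo_space (subtopology X (topspace X - {xh}))"
    using True \<open>closedin X {xh}\<close> by (intro clopen) auto
  ultimately show ?thesis
    using True wo_space_clopen_split by blast
next
  case limit: False
  have "\<exists>\<alpha> g. peaks_at X xh (\<alpha>::'c) g"
    using cleave[of "{xh}"] xh ex_peaks_at[OF _ _ xh limit] by blast
  then obtain \<alpha> :: 'c where \<alpha>: "\<exists>g. peaks_at X xh \<alpha> g"
      and least: "\<And>\<beta>. \<beta> < \<alpha> \<Longrightarrow> \<not> (\<exists>g. peaks_at X xh \<beta> g)"
    using LeastI_ex[of "\<lambda>\<alpha>. \<exists>g. peaks_at X xh (\<alpha>::'c) g"]
      not_less_Least[of _ "\<lambda>\<alpha>. \<exists>g. peaks_at X xh (\<alpha>::'c) g"] by blast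
  then obtain g where g: "peaks_at X xh \<alpha> g"
    by blast
  then have gc: "ray_continuous X g" and g_xh: "g xh = \<alpha>"
    and below: "\<And>x. x \<in> topspace X \<Longrightarrow> x \<noteq> xh \<Longrightarrow> g x < \<alpha>"
    by (simp_all add: peaks_at_def)
  have regular: "\<exists>b<\<alpha>. \<forall>i<j. F i \<le> b" if "j < \<alpha>" "\<And>i. i < j \<Longrightarrow> F i < \<alpha>" for j F
    by (rule peaks_at_regular[OF g _ xh that(1)]) (use least that(2) in blast)+
  show ?thesis
  \<comment> \<open>Since \<open>\<alpha>\<close> is a limit, the first case means that it is
    \<omega>.\<close>
  proof (cases "\<forall>j<\<alpha>. finite {..<j}")
    case True
    show ?thesis
    proof (rule wo_space_fibrewise[OF gc])
      fix c
      let ?H = "{x \<in> topspace X. g x = c}"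
      consider "c = \<alpha>" | "c < \<alpha>" | "\<alpha> < c"
        by fastforce
      then show "(\<exists>p. ?H \<subseteq> {p}) \<or> openin X ?H \<and> wo_space (subtopology X ?H)"
      proof cases
        case 1
        then have "?H \<subseteq> {xh}"
          using below by fastforce
        then show ?thesis
          by blast
      next
        case 2
        \<comment> \<open>Only finitely many closed sets are removed from an open one.\<close>
        have H: "?H = {x \<in> topspace X. g x \<le> c} - (\<Union>i\<in>{..<c}. {x \<in> topspace X. g x \<le> i})"
          by (force simp: not_le intro: le_neq_trans)
        have "openin X ?H"
          unfolding H using True 2 gc
          by (intro openin_diff closedin_Union ray_continuous_openin_le)
             (auto intro: ray_continuous_closedin)
        moreover have "xh \<notin> ?H"
          using 2 g_xh by auto
        ultimately show ?thesis
          using clopen ray_continuous_fibre_closedin[OF gc, of c] by blast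
      next
        case 3
        then have "g x \<noteq> c" if "x \<in> topspace X" for x
          using below[OF that] g_xh by (cases "x = xh") auto
        then show ?thesis
          by blast
      qed
    qed
  next
    case False
    then obtain j where j: "j < \<alpha>" "infinite {..<j}"
      by blast
    interpret regular_limit \<alpha>
    proof
      show "\<exists>j. j < \<alpha>"
        using j(1) by blast
      show "\<exists>k>j. k < \<alpha>" if "j < \<alpha>" for j
        using peaks_at_limit[OF g limit xh that] .
      show "\<exists>b<\<alpha>. \<forall>i<j. F i \<le> b" if "j < \<alpha>" "\<And>i. i < j \<Longrightarrow> F i < \<alpha>" for j F
        by (rule regular[OF that(1)]) (rule that(2))
      \<comment> \<open>The naturals inject into the infinite segment below \<open>j\<close>, so
        regularity at \<open>j\<close> also bounds sequences.\<close>
      show "\<exists>b<\<alpha>. \<forall>n. G n \<le> b" if G: "\<And>n::nat. G n < \<alpha>" for G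
      proof -
        obtain e :: "nat \<Rightarrow> 'c" where e: "inj e" "range e \<subseteq> {..<j}"
          using infinite_countable_subset[OF j(2)] by blast
        obtain b where b: "b < \<alpha>" "\<forall>i<j. G (inv e i) \<le> b"
          using regular[OF j(1), of "\<lambda>i. G (inv e i)"] G by blast
        have "G n \<le> b" for n
          using b(2)[rule_format, of "e n"] e by (auto simp: inv_f_f)
        then show ?thesis
          using b(1) by blast
      qed
    qed
    \<comment> \<open>\<open>almost_clopen_fibres\<close> handles fibres over a set with stationary
      complement, hence over \<open>W\<close> and over \<open>- W\<close>; the maximum of the two
      functions serves both.\<close>
    obtain W where W: "stationary W" "stationary (- W)"
      using stationary_split by blast
    obtain F where F: "maps_below F" "\<And>i. i < \<alpha> \<Longrightarrow> closure_point F i \<Longrightarrow> i \<in> W \<Longrightarrow>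
        \<exists>s. openin X ({x \<in> topspace X. g x = i} - {s}) \<and> closedin X ({x \<in> topspace X. g x = i} - {s})"
      using almost_clopen_fibres[OF X gc cleave xh g_xh below W(2)] by blast
    obtain G where G: "maps_below G" "\<And>i. i < \<alpha> \<Longrightarrow> closure_point G i \<Longrightarrow> i \<in> - W \<Longrightarrow>
        \<exists>s. openin X ({x \<in> topspace X. g x = i} - {s}) \<and> closedin X ({x \<in> topspace X. g x = i} - {s})"
      using almost_clopen_fibres[OF X gc cleave xh g_xh below, of "- W"] W(1) by auto
    show ?thesis
    proof (rule wo_space_of_closure_points[OF gc xh g_xh below clopen maps_below_max[OF F(1) G(1)]])
      fix i assume "i < \<alpha>" "closure_point (\<lambda>j. max (F j) (G j)) i"
      then show "\<exists>s. openin X ({x \<in> topspace X. g x = i} - {s}) \<and> closedin X ({x \<in> topspace X. g x = i} - {s})"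
        using F(2)[of i] G(2)[of i] closure_point_max[of F G i] by blast
    qed
  qed
qed

section \<open>Cleavability over an ordinal\<close>

unbundle cardinal_syntax

text \<open>A well-ordered type with room for an initial copy of every well-order on \<open>'b\<close>.\<close>
typedef 'b hartogs = "UNIV :: 'b set set"
  by simp

instantiation hartogs :: (type) wellorder
begin

text \<open>The cardinal well-order on the subsets of \<open>'a\<close>, as a class instance so that
  \<open>LEAST\<close> and \<open><\<close> apply.\<close>

definition less_eq_hartogs :: "'a hartogs \<Rightarrow> 'a hartogs \<Rightarrow> bool" where
  "x \<le> y \<longleftrightarrow> (Rep_hartogs x, Rep_hartogs y) \<in> |UNIV :: 'a set set|"

definition less_hartogs :: "'a hartogs \<Rightarrow> 'a hartogs \<Rightarrow> bool" where
  "(x :: 'a hartogs) < y \<longleftrightarrow> x \<le> y \<and> x \<noteq> y"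

instance
proof
  let ?c = "|UNIV :: 'a set set|"
  have c: "Refl ?c" "trans ?c" "antisym ?c" "Total ?c" "wf (?c - Id)"
    using card_of_Well_order[of "UNIV :: 'a set set"] by (auto simp: order_on_defs)
  fix x y z :: "'a hartogs"
  show "x < y \<longleftrightarrow> x \<le> y \<and> \<not> y \<le> x"
    using c(3) unfolding less_hartogs_def less_eq_hartogs_def
    by (metis Rep_hartogs_inject antisymD)
  show "x \<le> x"
    using c(1) by (simp add: less_eq_hartogs_def refl_on_def Field_card_of)
  show "x \<le> y \<Longrightarrow> y \<le> z \<Longrightarrow> x \<le> z"
    using c(2) unfolding less_eq_hartogs_def by (rule transD)
  show "x \<le> y \<Longrightarrow> y \<le> x \<Longrightarrow> x = y"
    using c(3) unfolding less_eq_hartogs_def by (metis Rep_hartogs_inject antisymD)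
  show "x \<le> y \<or> y \<le> x"
    using c(1,4) unfolding less_eq_hartogs_def total_on_def refl_on_def Field_card_of by (metis UNIV_I)
  have "wf {(x :: 'a hartogs, y). x < y}"
  proof (rule wf_subset[OF wf_inv_image[OF c(5)]])
    show "{(x, y). x < y} \<subseteq> inv_image (?c - Id) Rep_hartogs"
      by (auto simp: less_hartogs_def less_eq_hartogs_def Rep_hartogs_inject)
  qed
  then show "P x" if "\<And>x. (\<And>y. y < x \<Longrightarrow> P y) \<Longrightarrow> P x" for P and x :: "'a hartogs"
    using that by (rule wf_induct_rule) auto
qed

end

text \<open>By Cantor's theorem the cardinal order of the power set does not embed into
  \<open>r\<close>, so \<open>r\<close> embeds into it, with an initial segment as image.\<close>

lemma ex_initial_embedding:
  fixes r :: "'b rel"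
  assumes r: "Well_order r"
  obtains e :: "'b \<Rightarrow> 'b hartogs"
  where "\<And>a b. a \<in> Field r \<Longrightarrow> b \<in> Field r \<Longrightarrow> e a < e b \<longleftrightarrow> (a, b) \<in> r \<and> a \<noteq> b"
    and "\<And>a y. a \<in> Field r \<Longrightarrow> y < e a \<Longrightarrow> y \<in> e ` Field r"
    and "inj_on e (Field r)"
proof -
  let ?c = "|UNIV :: 'b set set|"
  have "r \<le>o ?c"
  proof (rule ccontr)
    assume "\<not> r \<le>o ?c"
    then have "?c \<le>o r"
      using ordLeq_total[OF r card_of_Well_order] by blast
    then have "?c \<le>o |Field r|"
      using card_of_mono2 Field_card_of by metis
    also have "|Field r| \<le>o |UNIV :: 'b set|"
      by (rule card_of_mono1) simp
    also have "|UNIV :: 'b set| <o ?c"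
      using card_of_Pow[of "UNIV :: 'b set"] by simp
    finally show False
      using ordLess_irreflexive by blast
  qed
  then obtain f where "embed r ?c f"
    by (auto simp: ordLeq_def)
  then have f: "compat r ?c f" "inj_on f (Field r)" "wo_rel.ofilter ?c (f ` Field r)"
    using embed_iff_compat_inj_on_ofilter[OF r card_of_Well_order] by auto
  define e where "e a = Abs_hartogs (f a)" for a
  have Rep_e: "Rep_hartogs (e a) = f a" for a
    by (simp add: e_def Abs_hartogs_inverse)
  have inj: "inj_on e (Field r)"
    using f(2) Rep_e by (metis inj_on_def)
  have mono: "e a \<le> e b" if "(a, b) \<in> r" for a b
    using f(1) that by (auto simp: less_eq_hartogs_def Rep_e compat_def)
  have less: "e a < e b \<longleftrightarrow> (a, b) \<in> r \<and> a \<noteq> b" if ab: "a \<in> Field r" "b \<in> Field r" for a b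
  proof
    assume *: "e a < e b"
    have "Total r"
      using r by (simp add: order_on_defs)
    then have "(a, b) \<in> r \<or> (b, a) \<in> r"
      using ab * by (auto simp: total_on_def)
    then show "(a, b) \<in> r \<and> a \<noteq> b"
      using mono[of b a] * by auto
  next
    assume "(a, b) \<in> r \<and> a \<noteq> b"
    then show "e a < e b"
      using mono[of a b] inj ab by (auto simp: less_le inj_on_eq_iff)
  qed
  have "y \<in> e ` Field r" if "a \<in> Field r" "y < e a" for a y
  proof -
    have "Rep_hartogs y \<in> under ?c (f a)"
      using that(2) by (simp add: under_def less_hartogs_def less_eq_hartogs_def Rep_e)
    then have "Rep_hartogs y \<in> f ` Field r"
      using f(3) that(1) card_of_Well_order[of "UNIV :: 'b set set"]
      by (auto simp: wo_rel.ofilter_def wo_rel_def)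
    then show ?thesis
      by (metis (no_types, lifting) Rep_e Rep_hartogs_inject image_iff)
  qed
  then show thesis
    using that less inj by blast
qed

unbundle no cardinal_syntax

text \<open>A bound \<open>c\<close> outside the initial image lies above all of it, so its rays
  pull back to the whole space and the empty set; other rays come from \<open>r\<close>.\<close>

lemma ray_continuous_initial_embedding:
  assumes f: "continuous_map X (order_topology_rel r) f"
    and e: "\<And>a b. a \<in> Field r \<Longrightarrow> b \<in> Field r \<Longrightarrow> e a < e b \<longleftrightarrow> (a, b) \<in> r \<and> a \<noteq> b"
      "\<And>a y. a \<in> Field r \<Longrightarrow> y < e a \<Longrightarrow> y \<in> e ` Field r"
  shows "ray_continuous X (e \<circ> f)"
proof -
  have fX: "f x \<in> Field r" if "x \<in> topspace X" for x
    using continuous_map_image_subset_topspace[OF f] that by (auto simp: topspace_order_topology_rel)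
  have "openin X {x \<in> topspace X. (e \<circ> f) x < c} \<and> openin X {x \<in> topspace X. c < (e \<circ> f) x}" for c
  proof (cases "c \<in> e ` Field r")
    case True
    then obtain b where b: "b \<in> Field r" "c = e b"
      by blast
    have eqs: "{x \<in> topspace X. (e \<circ> f) x < c} = {x \<in> topspace X. f x \<in> underS r b}"
        "{x \<in> topspace X. c < (e \<circ> f) x} = {x \<in> topspace X. f x \<in> aboveS r b}"
      using fX b by (auto simp: e(1) underS_def aboveS_def)
    show ?thesis
      unfolding eqs by (intro conjI openin_continuous_map_preimage[OF f] openin_order_topology_rays b(1))
  next
    case False
    then have less: "e (f x) < c" if "x \<in> topspace X" for x
      using e(2)[OF fX[OF that]] fX[OF that] by (metis image_eqI linorder_neqE)
    have eqs: "{x \<in> topspace X. (e \<circ> f) x < c} = topspace X"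
        "{x \<in> topspace X. c < (e \<circ> f) x} = {}"
      using less by (auto dest: less_asym)
    show ?thesis
      unfolding eqs by simp
  qed
  then show ?thesis
    by (simp add: ray_continuous_def)
qed

lemma cleaves_along_comp:
  assumes "cleaves_along X f A" "inj_on e B" "f ` topspace X \<subseteq> B" "A \<subseteq> topspace X"
  shows "cleaves_along X (e \<circ> f) A"
proof -
  have "(e \<circ> f) ` A \<inter> (e \<circ> f) ` (topspace X - A) = e ` (f ` A \<inter> f ` (topspace X - A))"
    unfolding image_comp[symmetric] using assms(2-4)
    by (intro inj_on_image_Int[symmetric]) auto
  then show ?thesis
    using assms(1) by (simp add: cleaves_along_def)
qed

section \<open>Scatteredness and the global well-order\<close>

text \<open>A set inside its own derived set survives all derivations and intersections, so it lies
  in \<open>{xh}\<close>, whose derived set is empty.\<close>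

lemma simple_space_scattered:
  assumes "simple_space X xh" and P: "P \<subseteq> X derived_set_of P"
  shows "P = {}"
proof -
  have P_top: "P \<subseteq> topspace X"
    using P derived_set_of_subset_topspace by (rule subset_trans)
  have "P \<subseteq> A" if "A \<in> CB_levels X" for A
    using that
  proof induction
    case top
    show ?case by (rule P_top)
  next
    case (deriv A)
    then show ?case
      using P derived_set_of_mono by (metis subset_trans)
  next
    case (inter F)
    then show ?case by blast
  qed
  then have "P \<subseteq> {xh}"
    using assms(1) by (simp add: simple_space_def)
  then have "X derived_set_of P \<subseteq> X derived_set_of {xh}"
    by (rule derived_set_of_mono)
  then show ?thesis
    using P assms(1) by (simp add: simple_space_def)
qed

text \<open>On the complement of \<open>V\<close>, \<open>f\<close> avoids \<open>f p\<close> and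
  hence, by \<open>fibre_limit\<close>, some \<open>(j, f p]\<close>, whose preimage is clopen. If
  \<open>f p\<close> is least, \<open>{p}\<close> is clopen.\<close>

lemma ex_clopen_neighbourhood:
  assumes "compact_space X" and f: "ray_continuous X f" "cleaves_along X f {p}"
    and V: "openin X V" "p \<in> V"
  shows "\<exists>U. openin X U \<and> closedin X U \<and> p \<in> U \<and> U \<subseteq> V"
proof -
  have p: "p \<in> topspace X"
    using openin_subset V by blast
  have neq: "f x \<noteq> f p" if "x \<in> topspace X" "x \<noteq> p" for x
    using cleaves_along_singleton[OF f(2) that] .
  show ?thesis
  proof (cases "\<exists>j. j < f p")
    case True
    have K: "closedin X (topspace X - V)"
      using V by blast
    have "\<not> (\<exists>x\<in>topspace X - V. f x = f p)"
      using neq V(2) by blast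
    then obtain j where j: "j < f p" "\<And>x. x \<in> topspace X - V \<Longrightarrow> \<not> (j < f x \<and> f x \<le> f p)"
      using fibre_limit[OF assms(1) f(1) K True] by blast
    define U where "U = {x \<in> topspace X. f x \<le> f p} - {x \<in> topspace X. f x \<le> j}"
    have "openin X U" "closedin X U"
      unfolding U_def
      by (intro openin_diff closedin_diff ray_continuous_openin_le[OF f(1)] ray_continuous_closedin[OF f(1)])+
    moreover have "p \<in> U"
      using p j(1) by (simp add: U_def not_le)
    moreover have "U \<subseteq> V"
      using j(2) not_le by (auto simp: U_def)
    ultimately show ?thesis
      by blast
  next
    case False
    then have "x = p" if "x \<in> topspace X" "f x \<le> f p" for x
      using neq[OF that(1)] that(2) by (auto simp: le_less)
    then have "{x \<in> topspace X. f x \<le> f p} = {p}"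
      using p by auto
    then show ?thesis
      using ray_continuous_openin_le[OF f(1), of "f p"] ray_continuous_closedin(1)[OF f(1), of "f p"] V(2)
      by (intro exI[of _ "{p}"]) simp
  qed
qed

lemma wo_space_compact_scattered_cleavable:
  fixes X :: "'a topology"
  assumes X: "compact_space X"
    and cleave: "\<And>A. A \<subseteq> topspace X \<Longrightarrow>
      \<exists>f :: 'a \<Rightarrow> 'c::wellorder. ray_continuous X f \<and> cleaves_along X f A"
    and scattered: "\<And>P. P \<subseteq> X derived_set_of P \<Longrightarrow> P = {}"
  shows "wo_space X"
proof -
  \<comment> \<open>An isolated point of the set of bad points has a clopen neighbourhood without further bad points.\<close>
  define good where "good x \<longleftrightarrow> (\<exists>C. x \<in> C \<and> openin X C \<and> closedin X C \<and> wo_space (subtopology X C))" for x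
  define B where "B = {x \<in> topspace X. \<not> good x}"
  have "B = {}"
  proof (rule scattered, rule subsetI, rule ccontr)
    fix b assume b: "b \<in> B" "b \<notin> X derived_set_of B"
    then obtain V where V: "openin X V" "b \<in> V" "\<And>y. y \<in> B \<Longrightarrow> y \<in> V \<Longrightarrow> y = b"
      unfolding in_derived_set_of by (auto simp: B_def)
    have bX: "b \<in> topspace X"
      using b(1) by (simp add: B_def)
    obtain f :: "'a \<Rightarrow> 'c" where f: "ray_continuous X f" "cleaves_along X f {b}"
      using cleave[of "{b}"] bX by auto
    obtain U where U: "openin X U" "closedin X U" "b \<in> U" "U \<subseteq> V"
      using ex_clopen_neighbourhood[OF X f V(1,2)] by blast
    have topU: "topspace (subtopology X U) = U"
      using openin_subset[OF U(1)] by auto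
    have "wo_space (subtopology X U)"
    proof (rule wo_space_at_point)
      show "compact_space (subtopology X U)"
        by (simp add: closedin_compact_space[OF X U(2)] compact_space_subtopology)
      show "b \<in> topspace (subtopology X U)"
        using U(3) topU by simp
      show "\<exists>f :: 'a \<Rightarrow> 'c. ray_continuous (subtopology X U) f \<and> cleaves_along (subtopology X U) f A"
        if A: "A \<subseteq> topspace (subtopology X U)" for A
      proof -
        have "A \<subseteq> topspace X"
          using A by simp
        then obtain f :: "'a \<Rightarrow> 'c" where "ray_continuous X f" "cleaves_along X f A"
          using cleave by blast
        then show ?thesis
          by (intro exI[of _ f] conjI ray_continuous_subtopology) (auto simp: cleaves_along_def)
      qed
      fix C assume C: "openin (subtopology X U) C" "closedin (subtopology X U) C" "b \<notin> C"
      have CX: "openin X C" "closedin X C" "C \<subseteq> U"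
        using C(1,2) U(1,2) by (auto simp: openin_open_subtopology closedin_closed_subtopology)
      have topC: "topspace (subtopology X C) = C"
        using openin_subset[OF CX(1)] by auto
      \<comment> \<open>\<open>b\<close> is the only bad point in \<open>V\<close>, so every point
        of \<open>C\<close> is good.\<close>
      have "wo_space (subtopology X C)"
      proof (rule wo_space_locally)
        show "compact_space (subtopology X C)"
          by (simp add: closedin_compact_space[OF X CX(2)] compact_space_subtopology)
        fix x assume "x \<in> topspace (subtopology X C)"
        then have x: "x \<in> C" "x \<in> topspace X"
          by auto
        then have "good x"
          using V(3)[of x] C(3) CX(3) U(4) by (auto simp: B_def)
        then obtain C' where C': "x \<in> C'" "openin X C'" "closedin X C'" "wo_space (subtopology X C')"
          by (auto simp: good_def)
        have "openin (subtopology X C) (C' \<inter> C)" "closedin (subtopology X C) (C' \<inter> C)"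
          using C' by (auto simp: openin_subtopology closedin_subtopology)
        moreover have "wo_space (subtopology (subtopology X C) (C' \<inter> C))"
          using wo_space_subtopology[OF C'(4), of C]
          by (simp add: subtopology_subtopology Int_ac)
        ultimately show "\<exists>D. x \<in> D \<and> openin (subtopology X C) D \<and> closedin (subtopology X C) D
            \<and> wo_space (subtopology (subtopology X C) D)"
          using C'(1) x(1) by blast
      qed
      then show "wo_space (subtopology (subtopology X U) C)"
        using CX(3) by (simp add: subtopology_subtopology Int_absorb1)
    qed
    then have "good b"
      using U unfolding good_def by blast
    then show False
      using b(1) by (simp add: B_def)
  qed
  then show ?thesis
    by (intro wo_space_locally X) (auto simp: B_def good_def)
qed

theorem theorem1p15:
  fixes X :: "'a topology" and xh :: 'a and r :: "'b rel"
  assumes "infinite (topspace X)"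
    and "compact_space X"
    and "simple_space X xh"
    and "Well_order r"
    and "infinite (Field r)"
    and "cleavable_over X (order_topology_rel r)"
    and "hereditarily_has_spine X r"
  shows "\<exists>s :: 'a rel. Well_order s \<and> X homeomorphic_space (order_topology_rel s)"
proof -
  \<comment> \<open>Passes from the relation \<open>r\<close> to a type of class
    \<open>wellorder\<close>, over which the lemmas above are stated.\<close>
  obtain e :: "'b \<Rightarrow> 'b hartogs"
    where e: "\<And>a b. a \<in> Field r \<Longrightarrow> b \<in> Field r \<Longrightarrow> e a < e b \<longleftrightarrow> (a, b) \<in> r \<and> a \<noteq> b"
      "\<And>a y. a \<in> Field r \<Longrightarrow> y < e a \<Longrightarrow> y \<in> e ` Field r"
      and inj: "inj_on e (Field r)"
    using ex_initial_embedding[OF assms(4)] by blast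
  have "\<exists>f :: 'a \<Rightarrow> 'b hartogs. ray_continuous X f \<and> cleaves_along X f A" if A: "A \<subseteq> topspace X" for A
  proof -
    obtain f where f: "continuous_map X (order_topology_rel r) f" "cleaves_along X f A"
      using assms(6) A unfolding cleavable_over_def by blast
    have "f ` topspace X \<subseteq> Field r"
      using continuous_map_image_subset_topspace[OF f(1)] by (simp add: topspace_order_topology_rel)
    then have "cleaves_along X (e \<circ> f) A"
      by (rule cleaves_along_comp[OF f(2) inj _ A])
    moreover have "ray_continuous X (e \<circ> f)"
      by (rule ray_continuous_initial_embedding[OF f(1) e])
    ultimately show ?thesis
      by blast
  qed
  then have "wo_space X"
    using assms(2) simple_space_scattered[OF assms(3)]
    by (intro wo_space_compact_scattered_cleavable)
  then obtain s where "wo_rays X s"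
    by (auto simp: wo_space_def)
  then show ?thesis
    using wo_rays_homeomorphic[OF assms(2)] by (auto simp: wo_rays_def)
qed

end
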